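(* Let $z\in\mathbb{C}\setminus(-\infty,0]$. Then $$\int_0^\infty J_1(cz)\,\ln(1+c^2)\,dc=2\,z^{-1}K_0(z).$$
   Context: $J_\nu:\mathbb{C}\setminus(-\infty,0]\to\mathbb{C}$ is the Bessel function of the first kind and $K_\nu:\mathbb{C}\setminus(-\infty,0]\to\mathbb{C}$ is the modified Bessel function of the second kind, of order $\nu$.
   Formalization: For non-real z the integral diverges (e.g. z = iy, where J_1(icy) = i I_1(cy)); the formal claim proves the identity as a convergent improper integral for real z > 0, and for other z reads the left side as its analytic continuation to the slit plane. *)

theory Defs
  imports "HOL-Complex_Analysis.Complex_Analysis"
begin

text \<open>
  Bessel functions of complex order \<open>\<nu>\<close> on the plane slit along the non-positive reals, given by
  their power series with the principal branch of the power. Values on the slit are not meaningful;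
  in particular \<open>0 powr 0 = 0\<close>, so \<open>Bessel_J 0 0\<close> is not \<open>1\<close>.
  Using \<open>rGamma\<close> makes the terms with a pole of the Gamma function vanish, as they should.
\<close>

definition Bessel_J :: "complex \<Rightarrow> complex \<Rightarrow> complex" where
  "Bessel_J \<nu> z =
     (z / 2) powr \<nu> *
     (\<Sum>k. (-1) ^ k * rGamma (\<nu> + of_nat k + 1) / fact k * (z / 2) ^ (2 * k))"

definition Bessel_I :: "complex \<Rightarrow> complex \<Rightarrow> complex" where
  "Bessel_I \<nu> z =
     (z / 2) powr \<nu> *
     (\<Sum>k. rGamma (\<nu> + of_nat k + 1) / fact k * (z / 2) ^ (2 * k))"

text \<open>
  The quotient defining the modified function of the second kind is \<open>0 / 0\<close> at integer orders,
  where the function is the limit in the order.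
\<close>

definition Bessel_K_quotient :: "complex \<Rightarrow> complex \<Rightarrow> complex" where
  "Bessel_K_quotient \<nu> z =
     of_real pi / 2 * (Bessel_I (- \<nu>) z - Bessel_I \<nu> z) / sin (of_real pi * \<nu>)"

definition Bessel_K :: "complex \<Rightarrow> complex \<Rightarrow> complex" where
  "Bessel_K \<nu> z =
     (if \<nu> \<in> \<int> then Lim (at \<nu>) (\<lambda>\<mu>. Bessel_K_quotient \<mu> z) else Bessel_K_quotient \<nu> z)"

text \<open>
  A pitfall about the integral of \<open>Bessel_J 1 (c * z) * ln (1 + c\<^sup>2)\<close> over \<open>c \<ge> 0\<close>: for positive
  real \<open>z\<close> it converges only conditionally, so it is not a Lebesgue integral; \<open>has_integral\<close> over
  \<open>{0..}\<close> is the limit of the integrals over \<open>{0..b}\<close>, that is, the improper integral. For non-real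
  \<open>z\<close> the integrand grows like \<open>exp (c * \<bar>Im z\<bar>)\<close> up to algebraic and logarithmic factors and
  the integral diverges. As a function on the slit plane, the integral is therefore understood as
  the analytic continuation, unique by the identity theorem, of its values on the positive reals.
\<close>

end

theory Submission
  imports Defs
begin

text \<open>
  For \<open>x > 0\<close> and \<open>y = x\<^sup>2 / 4\<close>, integration by parts and the substitution \<open>v = c\<^sup>2\<close> turn the integral
  into \<open>1 / x\<close> times the integral of \<open>J\<^sub>0 (x \<surd>v) / (1 + v)\<close> over \<open>v > 0\<close>, which converges absolutely
  because \<open>J\<^sub>0 (s) = O(s powr (- 1 / 2))\<close>; the same bound makes the boundary term vanish. Writing
  \<open>1 / (1 + v)\<close> as a Laplace integral and applying Fubini's theorem gives the integral of
  \<open>exp (- a - y / a) / a\<close> over \<open>a > 0\<close>. As a function of \<open>y\<close> this solves the same differential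
  equation as the series of \<open>2 K\<^sub>0 (x)\<close>, which comes from differentiating \<open>I\<^sub>\<nu>\<close> in the order, and both
  have the expansion \<open>- ln y - 2 \<gamma> + o(1)\<close> at \<open>0\<close>, so they agree.
\<close>

subsection \<open>The power series of the Bessel functions\<close>

text \<open>All series are taken in \<open>y = x\<^sup>2 / 4\<close>:
  \<open>powser bessel_coeff\<close> is I_0(x) at \<open>y\<close> and J_0(x sqrt v) at
  \<open>- (v * y)\<close>, so one entire function and its derivative serve J_0, J_1 and K_0. The
  Laplace transform is elementary term by term, but exchanging the integrals over v and a needs
  absolute integrability. That rests on a decay of J_0 which its alternating series does not reveal,
  hence the separate energy argument. The integral over a diverges logarithmically at y = 0, so the
  constant in its expansion cannot be found by setting y = 0. It comes from \<Gamma>'(1) = -\<gamma>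
  once the logarithm has been split off. The original integral over c is not absolutely convergent
  and is reached only as a limit of integrals over \<open>{0..b}\<close>. Only positive arguments
  occur there; complex z enters through the holomorphy of K_0 alone.\<close>

definition bessel_coeff :: "nat \<Rightarrow> 'a::{real_normed_field,banach}" where
  "bessel_coeff n = inverse (fact n ^ 2)"

text \<open>The harmonic numbers come from differentiating the Gamma factors of I_\<nu> in the
  order: Digamma at n + 1 is \<open>harm n\<close> minus Euler's constant.\<close>

definition bessel_harm_coeff :: "nat \<Rightarrow> 'a::{real_normed_field,banach}" where
  "bessel_harm_coeff n = harm n * inverse (fact n ^ 2)"

definition powser :: "(nat \<Rightarrow> 'a) \<Rightarrow> 'a \<Rightarrow> 'a::{real_normed_field,banach}" where
  "powser c x = (\<Sum>n. c n * x ^ n)"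

definition entire_coeff :: "(nat \<Rightarrow> 'a::{real_normed_field,banach}) \<Rightarrow> bool" where
  "entire_coeff c \<longleftrightarrow> (\<forall>x. summable (\<lambda>n. c n * x ^ n))"

lemma entire_coeff_bound:
  assumes "\<And>n. norm (c n) \<le> 1 / fact n"
  shows "entire_coeff c"
  unfolding entire_coeff_def
proof
  fix x
  show "summable (\<lambda>n. c n * x ^ n)"
  proof (rule summable_comparison_test[OF _ summable_norm_exp[of x]], intro exI allI impI)
    fix n :: nat
    show "norm (c n * x ^ n) \<le> norm (x ^ n /\<^sub>R fact n)"
      using mult_right_mono[OF assms[of n], of "norm (x ^ n)"]
      by (simp add: norm_mult divide_inverse)
  qed
qed

lemma entire_coeff_diffs: "entire_coeff c \<Longrightarrow> entire_coeff (diffs c)"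
  unfolding entire_coeff_def using termdiff_converges_all by blast

lemma powser_has_field_derivative:
  assumes "entire_coeff c"
  shows "(powser c has_field_derivative powser (diffs c) x) (at x within A)"
  using termdiffs_strong_converges_everywhere[of c x] assms
  unfolding powser_def entire_coeff_def
  by (auto intro: has_field_derivative_at_within)

lemma powser_has_field_derivative_compose:
  assumes "entire_coeff c" "(g has_field_derivative g') (at x within A)"
  shows "((\<lambda>x. powser c (g x)) has_field_derivative powser (diffs c) (g x) * g') (at x within A)"
  using powser_has_field_derivative[OF assms(1)] assms(2) by (rule DERIV_chain2)

lemma continuous_on_powser:
  assumes "entire_coeff c" "continuous_on A g"
  shows "continuous_on A (\<lambda>x. powser c (g x))"
  by (rule continuous_on_compose2[OF _ assms(2), of UNIV])
     (use powser_has_field_derivative[OF assms(1)] in \<open>auto intro: DERIV_continuous_on\<close>)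

lemma powser_0 [simp]: "powser c 0 = c 0"
  by (simp add: powser_def)

text \<open>The operator u \<mapsto> (t u')' multiplies the n-th coefficient by n^2 and shifts it
  down by one. It is the left side of the Bessel equation y u'' + u' = u in self-adjoint form, so
  the equation becomes a recursion for coefficients.\<close>

lemma powser_mult_derivative:
  assumes "entire_coeff c"
  shows "((\<lambda>t. t * powser (diffs c) t) has_field_derivative
            powser (\<lambda>n. of_nat (Suc n) ^ 2 * c (Suc n)) x) (at x within A)"
proof -
  define d where "d = (\<lambda>n. of_nat n * c n)"
  have sd: "summable (\<lambda>n. diffs c n * t ^ n)" for t
    using entire_coeff_diffs[OF assms] by (simp add: entire_coeff_def)
  have "(\<lambda>n. d n * t ^ n) sums (t * powser (diffs c) t)" for t
  proof -
    have "(\<lambda>n. t * (of_nat n * c n * t ^ (n - Suc 0))) sums (t * powser (diffs c) t)"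
      unfolding powser_def by (intro sums_mult diffs_equiv sd)
    moreover have "t * (of_nat n * c n * t ^ (n - Suc 0)) = d n * t ^ n" for n
      by (cases n) (simp_all add: d_def)
    ultimately show ?thesis by simp
  qed
  hence eq: "t * powser (diffs c) t = powser d t" and sm: "summable (\<lambda>n. d n * t ^ n)" for t
    unfolding powser_def by (simp_all add: sums_iff)
  have "diffs d = (\<lambda>n. of_nat (Suc n) ^ 2 * c (Suc n))"
    by (simp add: fun_eq_iff diffs_def d_def power2_eq_square mult_ac)
  moreover have "entire_coeff d" using sm by (simp add: entire_coeff_def)
  ultimately show ?thesis
    using powser_has_field_derivative[of d x A] unfolding eq by simp
qed

lemma norm_harm_le: "norm (harm n :: 'a::{real_normed_field,banach}) \<le> real n"
proof (induction n)
  case (Suc n)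
  have "norm (harm (Suc n) :: 'a) \<le> norm (harm n :: 'a) + norm (inverse (of_nat (Suc n)) :: 'a)"
    unfolding harm_Suc by (rule norm_triangle_ineq)
  also have "norm (inverse (of_nat (Suc n)) :: 'a) \<le> 1"
    by (simp add: norm_divide inverse_eq_divide norm_of_nat del: of_nat_Suc)
  finally show ?case using Suc by simp
qed (simp add: harm_def)

lemma entire_bessel_coeff: "entire_coeff bessel_coeff"
  by (rule entire_coeff_bound)
     (simp add: bessel_coeff_def norm_divide norm_mult power2_eq_square field_simps fact_ge_1)

lemma entire_bessel_harm_coeff: "entire_coeff bessel_harm_coeff"
proof (rule entire_coeff_bound)
  fix n
  have "real n \<le> fact n" by (metis fact_ge_self of_nat_fact of_nat_le_iff)
  hence "norm (harm n :: 'a) \<le> fact n" using norm_harm_le[of n, where 'a = 'a] by linarith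
  thus "norm (bessel_harm_coeff n :: 'a) \<le> 1 / fact n"
    by (simp add: bessel_harm_coeff_def norm_mult norm_divide power2_eq_square field_simps)
qed

text \<open>These are the coefficients of the order-one functions: at \<open>- (s\<^sup>2)\<close>
  the differentiated series is J_1(2 s) / s.\<close>

lemma diffs_bessel_coeff: "diffs bessel_coeff n = inverse (fact n * fact (Suc n))"
  unfolding diffs_def bessel_coeff_def
  by (simp add: divide_simps power2_eq_square del: of_nat_Suc)

lemma bessel_series_derivative:
  "((\<lambda>t. t * powser (diffs bessel_coeff) t) has_field_derivative powser bessel_coeff x) (at x within A)"
proof -
  have "(\<lambda>n. of_nat (Suc n) ^ 2 * bessel_coeff (Suc n)) = (bessel_coeff :: nat \<Rightarrow> 'a)"
    by (auto simp: fun_eq_iff bessel_coeff_def field_simps power2_eq_square simp del: of_nat_Suc)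
  thus ?thesis using powser_mult_derivative[OF entire_bessel_coeff, of x A] by simp
qed

lemma powser_add:
  assumes "entire_coeff c" "entire_coeff d"
  shows "powser (\<lambda>n. c n + d n) x = powser c x + powser d x"
  using assms unfolding powser_def entire_coeff_def by (simp add: suminf_add distrib_right)

text \<open>The extra term 1 / (n + 1) in \<open>harm (Suc n)\<close> produces the inhomogeneity p',
  where p is the series of \<open>bessel_coeff\<close>. It balances (y (p ln y)')' = p ln y + 2 p',
  so 2 q - p ln y solves the homogeneous equation, q being the series of
  \<open>bessel_harm_coeff\<close>.\<close>

lemma bessel_harm_series_derivative:
  "((\<lambda>t. t * powser (diffs bessel_harm_coeff) t) has_field_derivative
      powser bessel_harm_coeff x + powser (diffs bessel_coeff) x) (at x within A)"
proof -
  have "of_nat (Suc n) ^ 2 * bessel_harm_coeff (Suc n) =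
          bessel_harm_coeff n + (diffs bessel_coeff n :: 'a)" for n
    by (simp add: harm_Suc bessel_harm_coeff_def diffs_bessel_coeff field_simps power2_eq_square
             del: of_nat_Suc)
  thus ?thesis
    using powser_mult_derivative[OF entire_bessel_harm_coeff, of x A]
    by (simp add: powser_add entire_bessel_harm_coeff entire_coeff_diffs entire_bessel_coeff)
qed

lemma powser_of_real:
  assumes "entire_coeff c"
  shows "powser (\<lambda>n. of_real (c n)) (of_real x) = (of_real (powser c x) :: 'a::{real_normed_field,banach})"
proof -
  have "summable (\<lambda>n. c n * x ^ n)" using assms by (simp add: entire_coeff_def)
  from suminf_of_real[OF this, where 'a = 'a] show ?thesis by (simp add: powser_def)
qed

lemma bessel_coeff_of_real: "bessel_coeff = (\<lambda>n. of_real (bessel_coeff n))"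
  by (simp add: fun_eq_iff bessel_coeff_def)

lemma bessel_harm_coeff_of_real: "bessel_harm_coeff = (\<lambda>n. of_real (bessel_harm_coeff n))"
  by (simp add: fun_eq_iff bessel_harm_coeff_def harm_def)

subsection \<open>The series of \<open>K\<^sub>0\<close>\<close>

text \<open>The first factor has norm at least 1/2 and all later ones at least 1. Dividing
  rGamma(\<nu> + 1) by this symbol then bounds rGamma(\<nu> + k + 1) uniformly in both k and
  \<nu>.\<close>

lemma norm_pochhammer_ge:
  fixes \<nu> :: complex
  assumes "norm \<nu> \<le> 1/2"
  shows "norm (pochhammer (\<nu> + 1) k) \<ge> 1/2"
proof (induction k)
  case (Suc k)
  have *: "norm (\<nu> + 1 + of_nat k) \<ge> 1/2 + real k"
  proof -
    have "real (Suc k) = norm (of_nat (Suc k) :: complex)" by (simp only: norm_of_nat)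
    also have "\<dots> = norm ((\<nu> + 1 + of_nat k) - \<nu>)" by simp
    also have "\<dots> \<le> norm (\<nu> + 1 + of_nat k) + norm \<nu>" by (rule norm_triangle_ineq4)
    finally show ?thesis using assms by simp
  qed
  show ?case
  proof (cases "k = 0")
    case True
    thus ?thesis using * by simp
  next
    case False
    hence "norm (\<nu> + 1 + of_nat k) \<ge> 1" using * by linarith
    from mult_mono[OF Suc this] show ?thesis
      by (simp add: pochhammer_Suc norm_mult)
  qed
qed auto

text \<open>Numerator and sine both vanish to first order at \<nu> = 0, so K_0 is minus the
  derivative of I_\<nu> in the order, \<open>L\<close> below. A majorant uniform for small \<nu>
  permits termwise differentiation; the power contributes \<open>ln (z / 2)\<close> and rGamma
  contributes minus Digamma.\<close>

lemma Bessel_K_0_series: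
  assumes z: "z \<notin> \<real>\<^sub>\<le>\<^sub>0"
  shows "Bessel_K 0 z = - (ln (z / 2) + euler_mascheroni) * powser bessel_coeff ((z / 2)\<^sup>2)
                         + powser bessel_harm_coeff ((z / 2)\<^sup>2)"
proof -
  define w where "w = (z / 2)\<^sup>2"
  define f where "f = (\<lambda>k \<nu>. rGamma (\<nu> + of_nat k + 1) / fact k * w ^ k)"
  define f' where "f' = (\<lambda>k \<nu>. - rGamma (\<nu> + of_nat k + 1) * Digamma (\<nu> + of_nat k + 1) / fact k * w ^ k)"
  have nz: "z \<noteq> 0" using z by auto
  have "bounded ((\<lambda>\<nu>. rGamma (\<nu> + 1) :: complex) ` cball 0 (1/2))"
  proof (intro compact_imp_bounded compact_continuous_image)
    show "continuous_on (cball 0 (1/2)) (\<lambda>\<nu>. rGamma (\<nu> + 1) :: complex)"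
      by (rule continuous_on_compose2[OF continuous_on_rGamma[of UNIV]]) (auto intro!: continuous_intros)
  qed auto
  then obtain M where "\<forall>\<nu>\<in>cball 0 (1/2). norm (rGamma (\<nu> + 1) :: complex) \<le> M"
    by (auto simp: bounded_iff)
  hence M: "norm (rGamma (\<nu> + 1)) \<le> M" if "norm \<nu> \<le> 1/2" for \<nu> :: complex
    using that by auto
  have M0: "M \<ge> 0" using M[of 0] norm_ge_zero order_trans by (metis norm_zero zero_le_divide_1_iff zero_le_numeral)
  have bound: "norm (f k \<nu>) \<le> 2 * M * (norm w ^ k / fact k)" if \<nu>: "norm \<nu> \<le> 1/2" for k \<nu>
  proof -
    have "rGamma (\<nu> + 1) = pochhammer (\<nu> + 1) k * rGamma (\<nu> + of_nat k + 1)"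
      using pochhammer_rGamma[of "\<nu> + 1" k] by (simp add: add_ac)
    hence "norm (pochhammer (\<nu> + 1) k) * norm (rGamma (\<nu> + of_nat k + 1)) \<le> M"
      using M[OF \<nu>] by (simp add: norm_mult)
    moreover have "1/2 * norm (rGamma (\<nu> + of_nat k + 1)) \<le>
                     norm (pochhammer (\<nu> + 1) k) * norm (rGamma (\<nu> + of_nat k + 1))"
      by (intro mult_right_mono norm_pochhammer_ge \<nu>) auto
    ultimately have "norm (rGamma (\<nu> + of_nat k + 1)) \<le> 2 * M" by linarith
    from mult_right_mono[OF this, of "norm w ^ k / fact k"] show ?thesis
      by (simp add: f_def norm_mult norm_divide norm_power)
  qed
  have der: "(f k has_field_derivative f' k \<nu>) (at \<nu>)" if "\<nu> \<in> ball 0 (1/2)" for k \<nu>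
  proof -
    have "Re (\<nu> + of_nat k + 1) > 0"
      using abs_Re_le_cmod[of \<nu>] that by simp
    hence "\<nu> + of_nat k + 1 \<notin> \<int>\<^sub>\<le>\<^sub>0"
      using nonpos_Ints_subset_nonpos_Reals by (force simp: complex_nonpos_Reals_iff)
    thus ?thesis unfolding f_def f'_def
      by (auto intro!: derivative_eq_intros)
  qed
  have "\<exists>g g'. \<forall>\<nu> \<in> ball 0 (1/2). ((\<lambda>n. f n \<nu>) sums g \<nu>) \<and> ((\<lambda>n. f' n \<nu>) sums g' \<nu>) \<and>
            (g has_field_derivative g' \<nu>) (at \<nu>)"
  proof (rule series_and_derivative_comparison_complex)
    fix \<nu> :: complex assume "\<nu> \<in> ball 0 (1/2)"
    have "summable (\<lambda>k. complex_of_real (2 * M * (norm w ^ k / fact k)))"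
      using summable_exp[of "norm w"]
      by (intro summable_of_real summable_mult) (simp add: divide_inverse mult_ac)
    moreover have "range (\<lambda>k. complex_of_real (2 * M * (norm w ^ k / fact k))) \<subseteq> \<real>\<^sub>\<ge>\<^sub>0"
      using M0 by (auto simp: complex_nonneg_Reals_iff simp del: of_real_mult of_real_divide of_real_power)
    moreover have "norm (f n \<mu>) \<le> norm (complex_of_real (2 * M * (norm w ^ n / fact n)))"
      if "\<mu> \<in> ball \<nu> 1 \<inter> ball 0 (1/2)" for n \<mu>
      unfolding norm_of_real
      using order_trans[OF bound[of \<mu> n] abs_ge_self] that by auto
    ultimately show "\<exists>d h. 0 < d \<and> summable h \<and> range h \<subseteq> \<real>\<^sub>\<ge>\<^sub>0 \<and>
      (\<forall>\<^sub>F n in sequentially. \<forall>\<mu>\<in>ball \<nu> d \<inter> ball 0 (1/2). cmod (f n \<mu>) \<le> cmod (h n))"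
      by (intro exI[of _ 1] exI[of _ "\<lambda>k. complex_of_real (2 * M * (norm w ^ k / fact k))"])
         (auto simp del: of_real_mult of_real_divide of_real_power)
  qed (use der in auto)
  then obtain g g' where g: "\<And>\<nu>. \<nu> \<in> ball 0 (1/2) \<Longrightarrow> (\<lambda>n. f n \<nu>) sums g \<nu>"
    "\<And>\<nu>. \<nu> \<in> ball 0 (1/2) \<Longrightarrow> (\<lambda>n. f' n \<nu>) sums g' \<nu>"
    "\<And>\<nu>. \<nu> \<in> ball 0 (1/2) \<Longrightarrow> (g has_field_derivative g' \<nu>) (at \<nu>)" by metis
  have f0: "f n 0 = bessel_coeff n * w ^ n" for n
    using Gamma_fact[of n, where 'a = complex]
    by (simp add: f_def bessel_coeff_def rGamma_inverse_Gamma add_ac power2_eq_square divide_inverse)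
  have g0: "g 0 = powser bessel_coeff w"
    using g(1)[of 0] by (simp add: f0 powser_def sums_iff)
  have f'0: "f' n 0 = euler_mascheroni * (bessel_coeff n * w ^ n) - bessel_harm_coeff n * w ^ n" for n
  proof -
    have "f' n 0 = - (f n 0 * Digamma (of_nat (Suc n)))"
      by (simp add: f_def f'_def add_ac)
    thus ?thesis unfolding f0 Digamma_of_nat
      by (simp add: bessel_coeff_def bessel_harm_coeff_def algebra_simps)
  qed
  have g'0: "g' 0 = euler_mascheroni * powser bessel_coeff w - powser bessel_harm_coeff w"
  proof -
    have "(\<lambda>n. f' n 0) sums (euler_mascheroni * powser bessel_coeff w - powser bessel_harm_coeff w)"
      unfolding f'0 powser_def using entire_bessel_coeff entire_bessel_harm_coeff
      by (intro sums_diff sums_mult summable_sums) (auto simp: entire_coeff_def)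
    thus ?thesis using g(2)[of 0] sums_unique2 by auto
  qed
  define I where "I = (\<lambda>\<nu>. exp (\<nu> * ln (z / 2)) * g \<nu>)"
  have I: "Bessel_I \<nu> z = I \<nu>" if "\<nu> \<in> ball 0 (1/2)" for \<nu>
    using g(1)[OF that] nz
    by (simp add: Bessel_I_def I_def f_def w_def powr_def sums_iff power_mult)
  define L where "L = ln (z / 2) * g 0 + g' 0"
  have dI: "(I has_field_derivative L) (at 0)"
    unfolding I_def L_def by (auto intro!: derivative_eq_intros g(3))
  have dIm: "((\<lambda>\<nu>. I (-\<nu>)) has_field_derivative -L) (at 0)"
  proof -
    have "(uminus has_field_derivative -1) (at (0::complex))"
      by (auto intro!: derivative_eq_intros)
    with DERIV_chain2[of I L uminus 0 "-1" UNIV] dI show ?thesis by simp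
  qed
  have "((\<lambda>\<nu>. I (-\<nu>) - I \<nu>) has_field_derivative -L - L) (at 0)"
    by (intro DERIV_diff dI dIm)
  hence l1: "((\<lambda>\<nu>. (I (-\<nu>) - I \<nu>) / \<nu>) \<longlongrightarrow> -2 * L) (at 0)"
    by (simp add: has_field_derivative_iff)
  have "((\<lambda>\<nu>. sin (of_real pi * \<nu>)) has_field_derivative of_real pi) (at (0::complex))"
    by (auto intro!: derivative_eq_intros)
  hence l2: "((\<lambda>\<nu>. sin (of_real pi * \<nu>) / \<nu>) \<longlongrightarrow> complex_of_real pi) (at 0)"
    by (simp add: has_field_derivative_iff)
  have "((\<lambda>\<nu>. of_real pi / 2 * (((I (-\<nu>) - I \<nu>) / \<nu>) / (sin (of_real pi * \<nu>) / \<nu>)))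
           \<longlongrightarrow> of_real pi / 2 * ((-2 * L) / of_real pi)) (at 0)"
    by (intro tendsto_intros l1 l2) auto
  moreover have "eventually (\<lambda>\<nu>. of_real pi / 2 * (((I (-\<nu>) - I \<nu>) / \<nu>) / (sin (of_real pi * \<nu>) / \<nu>))
           = Bessel_K_quotient \<nu> z) (at 0)"
    unfolding eventually_at
    by (rule exI[of _ "1/2"]) (auto simp: Bessel_K_quotient_def I divide_simps)
  ultimately have "((\<lambda>\<nu>. Bessel_K_quotient \<nu> z) \<longlongrightarrow> of_real pi / 2 * ((-2 * L) / of_real pi)) (at 0)"
    by (rule Lim_transform_eventually)
  hence "Lim (at 0) (\<lambda>\<nu>. Bessel_K_quotient \<nu> z) = - L"
    by (subst tendsto_Lim) auto
  thus ?thesis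
    by (simp add: Bessel_K_def L_def g0 g'0 w_def algebra_simps)
qed

subsection \<open>The integral representation of \<open>K\<^sub>0\<close>\<close>

lemma has_integral_Ici_iff_Ioi:
  fixes f :: "real \<Rightarrow> 'a::banach"
  shows "(f has_integral i) {c..} \<longleftrightarrow> (f has_integral i) {c<..}"
  by (intro has_integral_spike_set_eq negligible_subset[OF negligible_sing[of c]]) auto

lemma has_integral_exp_Ioi:
  "c > 0 \<Longrightarrow> ((\<lambda>a::real. exp (- c * a)) has_integral 1 / c) {0<..}"
  using has_integral_exp_minus_to_infinity[of c 0] by (simp add: has_integral_Ici_iff_Ioi)

lemma Gamma_integral_real_Ioi:
  "x > 0 \<Longrightarrow> ((\<lambda>t. t powr (x - 1) / exp t) has_integral Gamma x) {0<..}"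
  for x :: real
  using Gamma_integral_real[of x] by (simp add: has_integral_Ici_iff_Ioi)

lemma absolutely_integrable_Ioi_dominated:
  fixes f g :: "real \<Rightarrow> real"
  assumes "continuous_on {0<..} f" "g integrable_on {0<..}" "\<And>a. a > 0 \<Longrightarrow> \<bar>f a\<bar> \<le> g a"
  shows "f absolutely_integrable_on {0<..}"
  by (rule measurable_bounded_by_integrable_imp_absolutely_integrable[OF _ _ assms(2)])
     (use assms in \<open>auto intro!: continuous_imp_measurable_on_sets_lebesgue\<close>)

text \<open>Absolute integrability refers to the completed measure, whereas the fundamental theorem
  and Fubini's theorem are applied over \<open>lborel\<close>; continuity supplies the Borel
  measurability.\<close>

lemma set_integrable_lborel_Ioi:
  fixes f :: "real \<Rightarrow> real"
  assumes "f absolutely_integrable_on {0<..}" "continuous_on {0<..} f"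
  shows "set_integrable lborel {0<..} f"
proof -
  have "(\<lambda>x. indicator {0<..} x *\<^sub>R f x) \<in> borel_measurable borel"
    using assms(2) by (intro borel_measurable_continuous_on_indicator) auto
  thus ?thesis using assms(1) integrable_completion[of "\<lambda>x. indicator {0<..} x *\<^sub>R f x" lborel]
    by (simp add: set_integrable_def)
qed

lemma integral_Ioi_derivative:
  fixes f F :: "real \<Rightarrow> real"
  assumes "\<And>a. a > 0 \<Longrightarrow> (F has_field_derivative f a) (at a)"
    and cont: "continuous_on {0<..} f" and "f absolutely_integrable_on {0<..}"
    and "(F \<longlongrightarrow> A) (at_right 0)" "(F \<longlongrightarrow> B) at_top"
  shows "integral {0<..} f = B - A"
proof -
  have si: "set_integrable lborel {0<..} f"
    using assms by (intro set_integrable_lborel_Ioi)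
  have e: "einterval 0 \<infinity> = {0::real<..}"
    by (auto simp: einterval_def)
  have c: "isCont f a" if "a > 0" for a
    using cont that by (simp add: continuous_on_eq_continuous_at)
  have "(LBINT x=0..\<infinity>. f x) = B - A"
    by (rule interval_integral_FTC_integrable[where F = F])
       (use assms c si in \<open>auto simp: e zero_ereal_def ereal_tendsto_simps
          has_real_derivative_iff_has_vector_derivative[symmetric] simp del: ereal_eq_0\<close>)
  also have "(LBINT x=0..\<infinity>. f x) = (LBINT x:{0<..}. f x)"
    using interval_integral_to_infinity_eq[of lborel 0 f] by (simp add: zero_ereal_def)
  also have "\<dots> = integral {0<..} f"
    by (rule set_borel_integral_eq_integral[OF si])
  finally show ?thesis .
qed

section \<open>Integrability and differentiation in the parameter y\<close>

lemma power_le_fact_exp: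
  fixes x :: real
  assumes "x \<ge> 0"
  shows "x ^ n \<le> fact n * exp x"
proof -
  have "(\<Sum>k\<in>{n}. x ^ k /\<^sub>R fact k) \<le> exp x"
    unfolding exp_def using assms by (intro sum_le_suminf summable_exp_generic) auto
  thus ?thesis by (simp add: field_simps)
qed

text \<open>The factor \<open>exp (- y / a)\<close> absorbs a pole of any order at a = 0; keep a
  single term of the exponential series at y / a.\<close>

lemma exp_minus_divide_power_le:
  fixes y a :: real
  assumes "y > 0" "a > 0"
  shows "exp (- y / a) / a ^ n \<le> fact n / y ^ n"
  using power_le_fact_exp[of "y / a" n] assms
  by (simp add: power_divide exp_minus field_simps)

text \<open>\<open>bessel_int 1 y\<close> is \<open>2 K\<^sub>0 (2 \<surd>y)\<close>.\<close>
definition bessel_int :: "nat \<Rightarrow> real \<Rightarrow> real" where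
  "bessel_int n y = integral {0<..} (\<lambda>a. exp (- a - y / a) / a ^ n)"

text \<open>Unlike \<open>bessel_int 1\<close>, this stays finite as y tends to 0: its limit is
  \<Gamma>'(1).\<close>

definition log_int :: "real \<Rightarrow> real" where
  "log_int y = integral {0<..} (\<lambda>a. ln a * exp (- a - y / a))"

lemma continuous_bessel_integrand [continuous_intros]:
  "continuous_on {0<..} (\<lambda>a::real. exp (- a - y / a) / a ^ n)"
  by (intro continuous_intros) auto

lemma bessel_integrand_absolutely_integrable:
  fixes y :: real
  assumes "y > 0"
  shows "(\<lambda>a. exp (- a - y / a) / a ^ n) absolutely_integrable_on {0<..}"
proof (rule absolutely_integrable_Ioi_dominated)
  show "(\<lambda>a. fact n / y ^ n * exp (- 1 * a)) integrable_on {0<..}"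
    using has_integral_exp_Ioi[of 1] by (intro integrable_on_mult_right) (auto simp: integrable_on_def)
  show "\<bar>exp (- a - y / a) / a ^ n\<bar> \<le> fact n / y ^ n * exp (- 1 * a)" if "a > 0" for a
  proof -
    have "exp (- a - y / a) / a ^ n = exp (- y / a) / a ^ n * exp (-a)"
      by (simp add: exp_add[symmetric])
    also have "\<dots> \<le> fact n / y ^ n * exp (-a)"
      by (intro mult_right_mono exp_minus_divide_power_le assms that) auto
    finally show ?thesis using that by simp
  qed
qed (rule continuous_bessel_integrand)

lemma abs_ln_le: "a > 0 \<Longrightarrow> \<bar>ln a\<bar> \<le> a + 1 / a" for a :: real
proof -
  assume a: "a > 0"
  hence "1 / a > 0" by simp
  moreover have "ln (1 / a) = - ln a" using a by (simp add: ln_div)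
  ultimately show ?thesis using ln_le_minus_one[of a] ln_le_minus_one[of "1 / a"] a by linarith
qed

lemma log_integrand_absolutely_integrable:
  fixes y :: real
  assumes "y > 0"
  shows "(\<lambda>a. ln a * exp (- a - y / a) / a ^ n) absolutely_integrable_on {0<..}"
proof (rule absolutely_integrable_Ioi_dominated)
  \<comment> \<open>From |ln a| \<le> a + 1 / a: the factor a is paid for by halving the decay rate,
    the factor 1 / a by raising the power by one.\<close>
  let ?g = "\<lambda>a. 2 * (fact n / y ^ n) * exp (- (1 / 2) * a) + fact (Suc n) / y ^ Suc n * exp (- 1 * a)"
  show "?g integrable_on {0<..}"
    using has_integral_exp_Ioi[of 1] has_integral_exp_Ioi[of "1/2"]
    by (intro integrable_add integrable_on_mult_right) (auto simp: integrable_on_def)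
  show "\<bar>ln a * exp (- a - y / a) / a ^ n\<bar> \<le> ?g a" if a: "a > 0" for a
  proof -
    have "a / 2 \<le> exp (a / 2)" using exp_ge_add_one_self[of "a/2"] by linarith
    hence "a * exp (-a) \<le> 2 * exp (a / 2) * exp (-a)" by (intro mult_right_mono) auto
    also have "\<dots> = 2 * exp (- (1/2) * a)" by (simp add: exp_add[symmetric])
    finally have e: "a * exp (-a) \<le> 2 * exp (- (1/2) * a)" .
    have "\<bar>ln a * exp (- a - y / a) / a ^ n\<bar> = \<bar>ln a\<bar> * (exp (- a - y / a) / a ^ n)"
      using a by (simp add: abs_mult)
    also have "\<dots> \<le> (a + 1 / a) * (exp (- a - y / a) / a ^ n)"
      using a by (intro mult_right_mono abs_ln_le) auto
    also have "(a + 1 / a) * (exp (- a - y / a) / a ^ n) =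
       (a * exp (-a)) * (exp (- y / a) / a ^ n) + (exp (- y / a) / a ^ Suc n) * exp (-a)"
    proof -
      have "exp (- a - y / a) = exp (-a) * exp (- y / a)" by (simp add: exp_add[symmetric])
      thus ?thesis using a by (simp add: field_simps)
    qed
    also have "\<dots> \<le> (2 * exp (- (1/2) * a)) * (fact n / y ^ n) + fact (Suc n) / y ^ Suc n * exp (-a)"
      using a assms by (intro add_mono mult_mono e exp_minus_divide_power_le) (auto intro: order_refl)
    finally show ?thesis by (simp add: mult_ac)
  qed
qed (intro continuous_intros; auto)

lemma exp_diff_le: "exp s - exp t \<le> (s - t) * exp s" for s t :: real
proof -
  have "exp s * (1 + (t - s)) \<le> exp s * exp (t - s)"
    by (intro mult_left_mono exp_ge_add_one_self) auto
  thus ?thesis by (simp add: exp_diff algebra_simps)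
qed

text \<open>Convexity makes the remainder nonnegative and bounds it by (s - t) (exp s - exp t), to
  which the same inequality applies again. A common bound m on both exponents, instead of one
  depending on s, is what allows integration over a afterwards.\<close>

lemma exp_taylor_bound:
  fixes s t m :: real
  assumes "s \<le> m" "t \<le> m"
  shows "\<bar>exp s - exp t - (s - t) * exp t\<bar> \<le> (s - t)\<^sup>2 * exp m"
proof -
  have 1: "(t - s) * exp t \<ge> exp t - exp s" using exp_diff_le[of t s] .
  have 2: "\<bar>exp s - exp t\<bar> \<le> \<bar>s - t\<bar> * exp m"
  proof -
    have "\<bar>exp s - exp t\<bar> \<le> \<bar>s - t\<bar> * exp (max s t)"
      using exp_diff_le[of s t] exp_diff_le[of t s] by (auto simp: max_def abs_if algebra_simps)
    also have "\<dots> \<le> \<bar>s - t\<bar> * exp m" using assms by (intro mult_left_mono) auto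
    finally show ?thesis .
  qed
  have "exp s - exp t - (s - t) * exp t \<le> (s - t) * (exp s - exp t)"
    using exp_diff_le[of s t] by (simp add: algebra_simps)
  also have "\<dots> \<le> \<bar>s - t\<bar> * \<bar>exp s - exp t\<bar>" by (metis abs_ge_self abs_mult)
  also have "\<dots> \<le> \<bar>s - t\<bar> * (\<bar>s - t\<bar> * exp m)" by (intro mult_left_mono 2) auto
  finally have "exp s - exp t - (s - t) * exp t \<le> (s - t)\<^sup>2 * exp m"
    by (simp add: power2_eq_square mult.assoc[symmetric])
  moreover have "(s - t)\<^sup>2 * exp m \<ge> 0" by simp
  ultimately show ?thesis using 1 by (simp add: algebra_simps abs_le_iff)
qed

lemma bessel_int_has_derivative:
  assumes y: "y > 0"
  shows "(bessel_int n has_field_derivative - bessel_int (Suc n) y) (at y)"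
proof -
  \<comment> \<open>For |h| < y / 2 both exponents are at most - (y / 2) / a, and the quadratic
    remainder carries (h / a)^2. This gives the argument y / 2 and the two extra powers of
    a.\<close>
  define C where "C = bessel_int (n + 2) (y / 2)"
  note int = absolutely_integrable_on_def[THEN iffD1, OF bessel_integrand_absolutely_integrable, THEN conjunct1]
  have bound: "\<bar>bessel_int n (y + h) - bessel_int n y + h * bessel_int (Suc n) y\<bar> \<le> h\<^sup>2 * C"
    if h: "\<bar>h\<bar> < y / 2" for h
  proof -
    have y': "y + h > 0" using h y by linarith
    let ?f = "\<lambda>a. exp (- a - (y + h) / a) / a ^ n - exp (- a - y / a) / a ^ n
                     + h * (exp (- a - y / a) / a ^ Suc n)"
    let ?g = "\<lambda>a. h\<^sup>2 * (exp (- a - (y / 2) / a) / a ^ (n + 2))"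
    have f: "(?f has_integral bessel_int n (y + h) - bessel_int n y + h * bessel_int (Suc n) y) {0<..}"
      unfolding bessel_int_def using int[OF y] int[OF y']
      by (intro has_integral_add has_integral_diff has_integral_mult_right integrable_integral)
    have g: "(?g has_integral h\<^sup>2 * C) {0<..}"
      unfolding bessel_int_def C_def using y
      by (intro has_integral_mult_right integrable_integral int) auto
    have "norm (integral {0<..} ?f) \<le> integral {0<..} ?g"
    proof (rule integral_norm_bound_integral)
      fix a :: real assume "a \<in> {0<..}"
      hence a: "a > 0" by simp
      have "\<bar>exp (- (y + h) / a) - exp (- y / a) - (- (y + h) / a - (- y / a)) * exp (- y / a)\<bar>
              \<le> (- (y + h) / a - (- y / a))\<^sup>2 * exp (- (y / 2) / a)"
        proof (rule exp_taylor_bound)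
          have "y / 2 / a \<le> (y + h) / a" "y / 2 / a \<le> y / a"
            using a h y by (auto intro!: divide_right_mono simp del: divide_divide_eq_left)
          thus "- (y + h) / a \<le> - (y / 2) / a" "- y / a \<le> - (y / 2) / a"
            unfolding minus_divide_left[symmetric] by (simp_all only: neg_le_iff_le)
        qed
      also have "(- (y + h) / a - (- y / a)) = - h / a" using a by (simp add: field_simps)
      finally have *: "\<bar>exp (- (y + h) / a) - exp (- y / a) + h / a * exp (- y / a)\<bar>
              \<le> (h / a)\<^sup>2 * exp (- (y / 2) / a)" by simp
      have s: "exp (- a - t / a) = exp (-a) * exp (- t / a)" for t
        by (simp add: exp_add[symmetric])
      have "?f a = exp (-a) / a ^ n * (exp (- (y + h) / a) - exp (- y / a) + h / a * exp (- y / a))"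
        unfolding s using a by (simp add: field_simps)
      hence "norm (?f a) = exp (-a) / a ^ n *
                \<bar>exp (- (y + h) / a) - exp (- y / a) + h / a * exp (- y / a)\<bar>"
        using a by (simp add: abs_mult)
      also have "\<dots> \<le> exp (-a) / a ^ n * ((h / a)\<^sup>2 * exp (- (y / 2) / a))"
        using a by (intro mult_left_mono *) auto
      also have "\<dots> = ?g a" unfolding s using a by (simp add: field_simps power2_eq_square)
      finally show "norm (?f a) \<le> ?g a" .
    qed (use f g in \<open>auto simp: has_integral_iff\<close>)
    thus ?thesis using f g by (simp add: has_integral_iff)
  qed
  have "((\<lambda>h. (bessel_int n (y + h) - bessel_int n y) / h + bessel_int (Suc n) y) \<longlongrightarrow> 0) (at 0)"
  proof (rule Lim_null_comparison)
    show "eventually (\<lambda>h. norm ((bessel_int n (y + h) - bessel_int n y) / h + bessel_int (Suc n) y)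
            \<le> \<bar>h\<bar> * C) (at 0)"
      unfolding eventually_at
    proof (intro exI[of _ "y / 2"] conjI ballI impI)
      fix h :: real assume h: "h \<noteq> 0 \<and> dist h 0 < y / 2"
      have "\<bar>h\<bar> * norm ((bessel_int n (y + h) - bessel_int n y) / h + bessel_int (Suc n) y) =
            \<bar>bessel_int n (y + h) - bessel_int n y + h * bessel_int (Suc n) y\<bar>"
        using h by (simp add: abs_mult[symmetric] field_simps)
      also have "\<dots> \<le> \<bar>h\<bar> * (\<bar>h\<bar> * C)"
        using bound[of h] h by (simp add: power2_eq_square mult.assoc[symmetric])
      finally show "norm ((bessel_int n (y + h) - bessel_int n y) / h + bessel_int (Suc n) y) \<le> \<bar>h\<bar> * C"
        using h by simp
    qed (use y in auto)
    show "((\<lambda>h. \<bar>h\<bar> * C) \<longlongrightarrow> 0) (at 0)" by (auto intro!: tendsto_eq_intros)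
  qed
  from tendsto_diff[OF this tendsto_const[of "bessel_int (Suc n) y"]]
  show ?thesis by (simp add: DERIV_def)
qed

section \<open>The symmetry a \<mapsto> y / a\<close>

text \<open>The substitution a \<mapsto> y / a is an involution of the half-line with Jacobian y /
  a^2. It is useful because it leaves the exponent a + y / a invariant.\<close>

lemma integral_Ioi_reciprocal:
  fixes f :: "real \<Rightarrow> real"
  assumes "y > 0" "f absolutely_integrable_on {0<..}"
  shows "integral {0<..} (\<lambda>a. y / a ^ 2 * f (y / a)) = integral {0<..} f"
proof -
  have img: "(\<lambda>a. y / a) ` {0<..} = {0<..}"
  proof safe
    fix x :: real assume "x > 0"
    thus "x \<in> (\<lambda>a. y / a) ` {0<..}" using assms(1)
      by (intro image_eqI[of _ _ "y / x"]) auto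
  qed (use assms in auto)
  have "(\<lambda>x. \<bar>- y / x ^ 2\<bar> * f (y / x)) absolutely_integrable_on {0<..} \<and>
           integral {0<..} (\<lambda>x. \<bar>- y / x ^ 2\<bar> * f (y / x)) = integral {0<..} f
     \<longleftrightarrow> f absolutely_integrable_on ((\<lambda>a. y / a) ` {0<..}) \<and>
         integral ((\<lambda>a. y / a) ` {0<..}) f = integral {0<..} f"
    by (rule has_absolute_integral_change_of_variables_1')
       (use assms in \<open>auto intro!: derivative_eq_intros simp: inj_on_def power2_eq_square\<close>)
  thus ?thesis using assms unfolding img by simp
qed

text \<open>This is the differential equation in disguise: with u = \<open>bessel_int 1\<close> it
  says y u' = - \<open>bessel_int 0\<close>, and differentiating once more gives (y u')' =
  u.\<close>

lemma bessel_int_2: "y > 0 \<Longrightarrow> y * bessel_int 2 y = bessel_int 0 y"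
proof -
  assume y: "y > 0"
  have "integral {0<..} (\<lambda>a. y / a ^ 2 * (exp (- (y / a) - y / (y / a)) / (y / a) ^ 0)) = bessel_int 0 y"
    unfolding bessel_int_def
    using integral_Ioi_reciprocal[OF y bessel_integrand_absolutely_integrable[OF y, of 0]] by simp
  also have "integral {0<..} (\<lambda>a. y / a ^ 2 * (exp (- (y / a) - y / (y / a)) / (y / a) ^ 0)) =
             integral {0<..} (\<lambda>a. y * (exp (- a - y / a) / a ^ 2))"
    using y by (intro integral_cong) (auto simp: minus_diff_commute)
  also have "\<dots> = y * bessel_int 2 y"
    unfolding bessel_int_def by (rule integral_mult_right)
  finally show ?thesis by simp
qed

text \<open>
  Integrating the derivative of \<open>ln a * exp (- a - y / a)\<close>; the substitution \<open>a \<mapsto> y / a\<close> brings the term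
  with \<open>y / a\<^sup>2\<close> back to \<open>log_int\<close>. This isolates the logarithmic singularity at \<open>y = 0\<close>.
\<close>
lemma bessel_int_1_eq:
  assumes y: "y > 0"
  shows "bessel_int 1 y = 2 * log_int y - ln y * bessel_int 0 y"
proof -
  let ?e = "\<lambda>a. exp (- a - y / a)"
  let ?f = "\<lambda>a. ?e a / a ^ 1 - ln a * ?e a / a ^ 0 + y * (ln a * ?e a / a ^ 2)"
  have ai: "?f absolutely_integrable_on {0<..}"
    by (intro set_integral_add set_integral_diff set_integrable_mult_right
          bessel_integrand_absolutely_integrable log_integrand_absolutely_integrable y)
  have i1: "(\<lambda>a. ?e a / a ^ n) integrable_on {0<..}" and
       i2: "(\<lambda>a. ln a * ?e a / a ^ n) integrable_on {0<..}" for n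
    using bessel_integrand_absolutely_integrable[OF y, of n]
          log_integrand_absolutely_integrable[OF y, of n] by (auto simp: absolutely_integrable_on_def)
  have "integral {0<..} ?f = 0 - 0"
  proof (rule integral_Ioi_derivative)
    show "((\<lambda>a. ln a * ?e a) has_field_derivative ?f a) (at a)" if "a > 0" for a
      using that by (auto intro!: derivative_eq_intros simp: field_simps power2_eq_square)
    show "continuous_on {0<..} ?f" by (intro continuous_intros) auto
    show "((\<lambda>a. ln a * ?e a) \<longlongrightarrow> 0) (at_right 0)" using y by real_asymp
    show "((\<lambda>a. ln a * ?e a) \<longlongrightarrow> 0) at_top" using y by real_asymp
  qed (rule ai)
  moreover have "integral {0<..} ?f = bessel_int 1 y - log_int y
      + integral {0<..} (\<lambda>a. y * (ln a * ?e a / a ^ 2))"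
    unfolding bessel_int_def log_int_def using i1[of 1] i2[of 0] integrable_on_mult_right[OF i2[of 2], of y]
    by (simp add: integral_add integral_diff integrable_diff)
  moreover have "integral {0<..} (\<lambda>a. y * (ln a * ?e a / a ^ 2)) = ln y * bessel_int 0 y - log_int y"
  proof -
    \<comment> \<open>This is ln (y / b) times the symmetric exponential.\<close>
    let ?g = "\<lambda>b. ln y * (?e b / b ^ 0) - ln b * ?e b / b ^ 0"
    have "?g absolutely_integrable_on {0<..}"
      by (intro set_integral_diff set_integrable_mult_right
          bessel_integrand_absolutely_integrable log_integrand_absolutely_integrable y)
    from integral_Ioi_reciprocal[OF y this]
    have "integral {0<..} ?g = integral {0<..} (\<lambda>a. y / a ^ 2 * ?g (y / a))" by simp
    also have "\<dots> = integral {0<..} (\<lambda>a. y * (ln a * ?e a / a ^ 2))"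
      using y by (intro integral_cong) (auto simp: ln_div minus_diff_commute algebra_simps)
    also have "integral {0<..} ?g = ln y * bessel_int 0 y - log_int y"
      unfolding bessel_int_def log_int_def using i1[of 0] i2[of 0] integrable_on_mult_right[OF i1[of 0], of "ln y"]
      by (simp add: integral_diff)
    finally show ?thesis by simp
  qed
  ultimately show ?thesis by simp
qed

section \<open>Behaviour of the integrals as y tends to 0\<close>

text \<open>A majorant independent of \<nu>, for the limit \<nu> \<rightarrow> 0 under the integral.
  The quotient lies between ln a and a^\<nu> ln a; the exponent -1/2 keeps the lower bound
  integrable at 0.\<close>

lemma abs_powr_minus_one_le:
  fixes a \<nu> :: real
  assumes "a > 0" "\<nu> > 0" "\<nu> \<le> 1"
  shows "\<bar>(a powr \<nu> - 1) / \<nu>\<bar> \<le> a\<^sup>2 + 2 * a powr (-1/2)"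
proof -
  have up: "a powr \<nu> - 1 \<le> \<nu> * ln a * a powr \<nu>"
    using exp_diff_le[of "\<nu> * ln a" 0] assms by (simp add: powr_def)
  have lo: "\<nu> * ln a \<le> a powr \<nu> - 1"
  proof -
    have "\<nu> * ln a \<le> exp (\<nu> * ln a) - 1" using exp_ge_add_one_self[of "\<nu> * ln a"] by linarith
    thus ?thesis using assms by (simp add: powr_def)
  qed
  have l: "- 2 * a powr (-1/2) \<le> ln a"
    using ln_le_minus_one[of "a powr (-1/2)"] assms by (simp add: ln_powr)
  have u: "ln a * a powr \<nu> \<le> a\<^sup>2"
  proof (cases "a \<ge> 1")
    case True
    have "a powr \<nu> \<le> a" using powr_mono[of \<nu> 1 a] True assms by simp
    moreover have "ln a \<le> a" using ln_le_minus_one[of a] assms by linarith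
    ultimately show ?thesis unfolding power2_eq_square using True by (intro mult_mono) auto
  next
    case False
    hence "ln a * a powr \<nu> \<le> 0" using assms by (intro mult_nonpos_nonneg) auto
    thus ?thesis using zero_le_power2[of a] by linarith
  qed
  have "(a powr \<nu> - 1) / \<nu> \<le> ln a * a powr \<nu>" "ln a \<le> (a powr \<nu> - 1) / \<nu>"
    using up lo assms by (simp_all add: field_simps)
  moreover have "0 \<le> a\<^sup>2" "0 \<le> a powr (-1/2)" by auto
  ultimately show ?thesis using l u unfolding abs_le_iff by linarith
qed

text \<open>This is \<Gamma>'(1) = -\<gamma>. The difference quotients of a^\<nu> at \<nu> = 0
  integrate against exp(-a) to those of \<Gamma> at 1, and dominated convergence is applied along
  \<nu> = 1 / (k + 1).\<close>

lemma has_integral_ln_exp: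
  "((\<lambda>a::real. ln a * exp (-a)) has_integral - euler_mascheroni) {0<..}"
proof -
  define \<nu> where "\<nu> = (\<lambda>k::nat. 1 / real (Suc k))"
  have \<nu>: "\<nu> k > 0" "\<nu> k \<le> 1" for k by (auto simp: \<nu>_def divide_simps)
  have \<nu>0: "\<nu> \<longlonglongrightarrow> 0" unfolding \<nu>_def by (rule LIMSEQ_Suc[OF lim_1_over_n])
  define f where "f = (\<lambda>k a. (a powr \<nu> k - 1) / \<nu> k * exp (-a))"
  define g where "g = (\<lambda>a::real. (a\<^sup>2 + 2 * a powr (-1/2)) * exp (-a))"
  have fint: "(f k has_integral (Gamma (1 + \<nu> k) - 1) / \<nu> k) {0<..}" for k
  proof -
    have "((\<lambda>a. 1 / \<nu> k * (a powr (1 + \<nu> k - 1) / exp a - exp (- 1 * a))) has_integral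
             1 / \<nu> k * (Gamma (1 + \<nu> k) - 1 / 1)) {0<..}"
      using \<nu>(1)[of k]
      by (intro has_integral_mult_right has_integral_diff Gamma_integral_real_Ioi has_integral_exp_Ioi) auto
    thus ?thesis
      by (simp add: f_def exp_minus field_simps)
  qed
  have gint: "g integrable_on {0<..}"
  proof -
    have "((\<lambda>a::real. a powr (3 - 1) / exp a + 2 * (a powr (1/2 - 1) / exp a)) has_integral
             Gamma 3 + 2 * Gamma (1/2)) {0<..}"
      by (intro has_integral_mult_right has_integral_add Gamma_integral_real_Ioi) auto
    hence "(\<lambda>a::real. a powr (3 - 1) / exp a + 2 * (a powr (1/2 - 1) / exp a)) integrable_on {0<..}"
      by (auto simp: integrable_on_def)
    moreover have "a powr (3 - 1) / exp a + 2 * (a powr (1/2 - 1) / exp a) = g a" if "a \<in> {0<..}" for a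
      using that by (simp add: g_def exp_minus field_simps)
    ultimately show ?thesis by (rule integrable_eq)
  qed
  have lim: "(\<lambda>k. f k a) \<longlonglongrightarrow> ln a * exp (-a)" if "a \<in> {0<..}" for a
  proof -
    have "((\<lambda>\<nu>. a powr \<nu>) has_field_derivative ln a) (at 0)"
      using that by (auto intro!: derivative_eq_intros)
    hence "((\<lambda>\<nu>. (a powr \<nu> - 1) / \<nu>) \<longlongrightarrow> ln a) (at 0)"
      using that by (simp add: has_field_derivative_iff)
    moreover have "filterlim \<nu> (at 0) sequentially"
      using \<nu>0 \<nu>(1) unfolding filterlim_at by (auto intro!: always_eventually less_imp_neq[symmetric])
    ultimately have "(\<lambda>k. (a powr \<nu> k - 1) / \<nu> k) \<longlonglongrightarrow> ln a"
      by (rule filterlim_compose)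
    thus ?thesis unfolding f_def by (intro tendsto_mult tendsto_const)
  qed
  have bd: "norm (f k a) \<le> g a" if "a \<in> {0<..}" for k a
    using mult_right_mono[OF abs_powr_minus_one_le[of a "\<nu> k"], of "exp (-a)"] \<nu>[of k] that
    by (simp add: f_def g_def abs_mult)

  have 1: "(\<lambda>a. ln a * exp (-a)) integrable_on {0::real<..}"
       "(\<lambda>k. integral {0<..} (f k)) \<longlonglongrightarrow> integral {0<..} (\<lambda>a. ln a * exp (-a))"
    using dominated_convergence[of f "{0<..}" g "\<lambda>a. ln a * exp (-a)"] fint gint bd lim
    by (auto simp: has_integral_iff)
  have "(\<lambda>k. integral {0<..} (f k)) \<longlonglongrightarrow> - euler_mascheroni"
  proof -
    have "(Gamma has_field_derivative Gamma 1 * Digamma 1) (at (1::real))"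
      by (rule has_field_derivative_Gamma) auto
    moreover have "Digamma (1::real) = - euler_mascheroni"
      using Digamma_of_nat[of 0, where 'a = real] by (simp add: harm_def)
    ultimately have "((\<lambda>h. (Gamma (1 + h) - 1) / h) \<longlongrightarrow> - euler_mascheroni) (at (0::real))"
      by (simp add: DERIV_def)
    moreover have "filterlim \<nu> (at 0) sequentially"
      using \<nu>0 \<nu>(1) unfolding filterlim_at by (auto intro!: always_eventually less_imp_neq[symmetric])
    ultimately have "(\<lambda>k. (Gamma (1 + \<nu> k) - 1) / \<nu> k) \<longlonglongrightarrow> - euler_mascheroni"
      by (rule filterlim_compose)
    moreover have "integral {0<..} (f k) = (Gamma (1 + \<nu> k) - 1) / \<nu> k" for k
      using fint[of k] by (simp add: has_integral_iff)
    ultimately show ?thesis by simp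
  qed
  with 1 show ?thesis by (metis LIMSEQ_unique has_integral_iff)
qed

text \<open>The bound is applied with u = y / a and integrated over a: a^(-1/2) is integrable at 0,
  whereas the sharper-looking bound u would give a^(-1), which is not.\<close>

lemma one_minus_exp_le_sqrt:
  fixes u :: real
  assumes "u \<ge> 0"
  shows "1 - exp (-u) \<le> sqrt u"
proof (cases "u \<le> 1")
  case True
  have "u \<le> sqrt u" using True assms
    by (intro real_le_rsqrt) (simp add: power2_eq_square mult_left_le)
  thus ?thesis using exp_ge_add_one_self[of "-u"] by linarith
next
  case False
  hence "sqrt u \<ge> 1" by simp
  thus ?thesis using exp_gt_zero[of "-u"] by linarith
qed

text \<open>A rate is needed beyond mere convergence: \<open>bessel_int 0 y - 1\<close> is later
  multiplied by \<open>ln y\<close>, which sqrt y still dominates.\<close>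

lemma integral_exp_reciprocal_bound:
  fixes f g :: "real \<Rightarrow> real"
  assumes y: "y > 0" and f: "(f has_integral I) {0<..}"
    and fy: "(\<lambda>a. f a * exp (- y / a)) integrable_on {0<..}"
    and g: "((\<lambda>a. g a * a powr (-1/2)) has_integral C) {0<..}"
    and le: "\<And>a. a > 0 \<Longrightarrow> \<bar>f a\<bar> \<le> g a"
  shows "\<bar>integral {0<..} (\<lambda>a. f a * exp (- y / a)) - I\<bar> \<le> sqrt y * C"
proof -
  have h1: "((\<lambda>a. f a * exp (- y / a) - f a) has_integral
          integral {0<..} (\<lambda>a. f a * exp (- y / a)) - I) {0<..}"
    using f fy by (intro has_integral_diff integrable_integral)
  have h2: "((\<lambda>a. sqrt y * (g a * a powr (-1/2))) has_integral sqrt y * C) {0<..}"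
    by (intro has_integral_mult_right g)
  have "norm (integral {0<..} (\<lambda>a. f a * exp (- y / a) - f a))
     \<le> integral {0<..} (\<lambda>a. sqrt y * (g a * a powr (-1/2)))"
  proof (rule integral_norm_bound_integral)
    fix a :: real assume "a \<in> {0<..}"
    hence a: "a > 0" by simp
    have "norm (f a * exp (- y / a) - f a) = \<bar>f a\<bar> * (1 - exp (- (y / a)))"
    proof -
      have "f a * exp (- y / a) - f a = f a * (exp (- (y / a)) - 1)" by (simp add: algebra_simps)
      thus ?thesis using a y by (simp add: abs_mult)
    qed
    also have "\<dots> \<le> g a * sqrt (y / a)"
      using a y by (intro mult_mono le one_minus_exp_le_sqrt) (auto intro: order_trans[OF abs_ge_zero le])
    also have "sqrt (y / a) = sqrt y * a powr (-1/2)"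
      using powr_minus_divide[of a "1/2"] powr_half_sqrt[of a] a by (simp add: real_sqrt_divide)
    finally show "norm (f a * exp (- y / a) - f a) \<le> sqrt y * (g a * a powr (-1/2))"
      by (simp add: mult_ac)
  qed (use h1 h2 in \<open>auto simp: has_integral_iff\<close>)
  thus ?thesis unfolding integral_unique[OF h1] integral_unique[OF h2] by simp
qed

lemma bessel_int_0_bound:
  assumes y: "y > 0"
  shows "\<bar>bessel_int 0 y - 1\<bar> \<le> sqrt y * Gamma (1/2)"
proof -
  have "\<bar>integral {0<..} (\<lambda>a. exp (-a) * exp (- y / a)) - 1\<bar> \<le> sqrt y * Gamma (1/2)"
  proof (rule integral_exp_reciprocal_bound[where g = "\<lambda>a. exp (-a)"])
    show "((\<lambda>a. exp (-a)) has_integral 1) {0::real<..}"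
      using has_integral_exp_Ioi[of 1] by simp
    show "(\<lambda>a. exp (-a) * exp (- y / a)) integrable_on {0<..}"
      using bessel_integrand_absolutely_integrable[OF y, of 0]
      by (auto simp: absolutely_integrable_on_def exp_add[symmetric])
    show "((\<lambda>a. exp (-a) * a powr (-1/2)) has_integral Gamma (1/2)) {0::real<..}"
      using Gamma_integral_real_Ioi[of "1/2"] by (simp add: exp_minus field_simps)
  qed (use y in auto)
  thus ?thesis by (simp add: bessel_int_def exp_add[symmetric])
qed

lemma log_int_bound:
  assumes y: "y > 0"
  shows "\<bar>log_int y + euler_mascheroni\<bar> \<le> sqrt y * (Gamma (3/2) + 4 * Gamma (1/4))"
proof -
  have "\<bar>integral {0<..} (\<lambda>a. (ln a * exp (-a)) * exp (- y / a)) - (- euler_mascheroni)\<bar>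
          \<le> sqrt y * (Gamma (3/2) + 4 * Gamma (1/4))"
  \<comment> \<open>The exponent -1/4 in the bound for - ln a leaves room for the further factor
    a^(-1/2): the product a^(-3/4) is integrable at 0 and yields \<Gamma>(1/4).\<close>
  proof (rule integral_exp_reciprocal_bound[where g = "\<lambda>a. (a + 4 * a powr (-1/4)) * exp (-a)"])
    show "(\<lambda>a. ln a * exp (-a) * exp (- y / a)) integrable_on {0<..}"
      using log_integrand_absolutely_integrable[OF y, of 0]
      by (auto simp: absolutely_integrable_on_def exp_add[symmetric] mult.assoc)
    have "((\<lambda>a. a powr (3/2 - 1) / exp a + 4 * (a powr (1/4 - 1) / exp a)) has_integral
             (Gamma (3/2) + 4 * Gamma (1/4))) {0::real<..}"
      by (intro has_integral_add has_integral_mult_right Gamma_integral_real_Ioi) auto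
    moreover have "a powr (3/2 - 1) / exp a + 4 * (a powr (1/4 - 1) / exp a) =
        (a + 4 * a powr (-1/4)) * exp (-a) * a powr (-1/2)" if "a \<in> {0<..}" for a :: real
    proof -
      have "a * a powr (-1/2) = a powr (3/2 - 1)" "a powr (-1/4) * a powr (-1/2) = a powr (1/4 - 1)"
        using that powr_add[of a 1 "-1/2"] by (simp_all add: powr_add[symmetric])
      thus ?thesis by (simp add: exp_minus field_simps)
    qed
    ultimately show "((\<lambda>a. (a + 4 * a powr (-1/4)) * exp (-a) * a powr (-1/2)) has_integral
             (Gamma (3/2) + 4 * Gamma (1/4))) {0::real<..}"
      by (rule has_integral_eq[rotated])
    show "\<bar>ln a * exp (-a)\<bar> \<le> (a + 4 * a powr (-1/4)) * exp (-a)" if "a > 0" for a :: real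
    proof -
      have "ln a \<le> a" using ln_le_minus_one[of a] that by linarith
      moreover have "- ln a \<le> 4 * a powr (-1/4)"
        using ln_le_minus_one[of "a powr (-1/4)"] that by (simp add: ln_powr)
      moreover have "a powr (-1/4) \<ge> 0" by simp
      ultimately have "\<bar>ln a\<bar> \<le> a + 4 * a powr (-1/4)" using that unfolding abs_le_iff by linarith
      thus ?thesis by (simp add: abs_mult)
    qed
  qed (use y has_integral_ln_exp in auto)
  thus ?thesis by (simp add: log_int_def exp_add[symmetric] mult.assoc)
qed

section \<open>Identification by uniqueness for the differential equation\<close>

lemma powser_bessel_coeff_pos:
  fixes y :: real
  assumes "y \<ge> 0"
  shows "powser bessel_coeff y > 0"
proof -
  have "(\<Sum>k\<in>{0}. bessel_coeff k * y ^ k) \<le> powser bessel_coeff y"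
    unfolding powser_def using assms entire_bessel_coeff
    by (intro sum_le_suminf) (auto simp: entire_coeff_def bessel_coeff_def)
  thus ?thesis by (simp add: bessel_coeff_def)
qed

text \<open>
  Both sides solve \<open>y u'' + u' = u\<close>, as does \<open>p = powser bessel_coeff\<close>. The Wronskian
  \<open>W\<close> of \<open>p\<close> and their difference \<open>D\<close> is constant, and \<open>W\<close> and \<open>D\<close> vanish
  as \<open>y\<close> tends to \<open>0\<close>; hence \<open>D / p\<close> is constantly \<open>0\<close>.
\<close>
lemma bessel_int_1_series:
  assumes "y > 0"
  shows "bessel_int 1 y = - (ln y + 2 * euler_mascheroni) * powser bessel_coeff y
            + 2 * powser bessel_harm_coeff y"
proof -
  define p p1 q q1 :: "real \<Rightarrow> real" where "p = powser bessel_coeff"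
    and "p1 = powser (diffs bessel_coeff)"
    and "q = powser bessel_harm_coeff" and "q1 = powser (diffs bessel_harm_coeff)"
  have dp: "(p has_field_derivative p1 x) (at x)" for x
    unfolding p_def p1_def by (rule powser_has_field_derivative[OF entire_bessel_coeff])
  have dq: "(q has_field_derivative q1 x) (at x)" for x
    unfolding q_def q1_def by (rule powser_has_field_derivative[OF entire_bessel_harm_coeff])
  define P Q where "P = (\<lambda>t. t * p1 t)" and "Q = (\<lambda>t. t * q1 t)"
  have dp1: "(P has_field_derivative p x) (at x)" for x
    unfolding P_def p_def p1_def by (rule bessel_series_derivative)
  have dq1: "(Q has_field_derivative q x + p1 x) (at x)" for x
    unfolding Q_def q_def q1_def p1_def by (rule bessel_harm_series_derivative)
  have p0: "p 0 = 1" and q0: "q 0 = 0"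
    by (simp_all add: p_def q_def bessel_coeff_def bessel_harm_coeff_def harm_def)
  have p_pos: "p t > 0" if "t > 0" for t
    using powser_bessel_coeff_pos[of t] that by (simp add: p_def)
  have p1_eq: "p1 t = P t / t" if "t > 0" for t using that by (simp add: P_def)
  define g :: real where "g = 2 * euler_mascheroni"
  define D where "D = (\<lambda>t. bessel_int 1 t + (ln t + g) * p t - 2 * q t)"
  \<comment> \<open>\<open>H t\<close> is t D'(t) and \<open>P t\<close> is t p'(t), so D' = H / t
    and H' = D express the equation as a first-order system, and \<open>W\<close> is t times the
    usual Wronskian.\<close>
  define H where "H = (\<lambda>t. - bessel_int 0 t + p t + (ln t + g) * P t - 2 * Q t)"
  define W where "W = (\<lambda>t. p t * H t - P t * D t)"
  have dD: "(D has_field_derivative H t / t) (at t)" if "t > 0" for t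
    unfolding D_def H_def using that bessel_int_2[of t]
    by (auto intro!: derivative_eq_intros dp dq bessel_int_has_derivative
             simp: field_simps numeral_2_eq_2 P_def Q_def)
  have dH: "(H has_field_derivative D t) (at t)" if "t > 0" for t
    unfolding D_def H_def using that
    by (auto intro!: derivative_eq_intros dp dp1 dq1 bessel_int_has_derivative simp: field_simps p1_eq)
  have dW: "(W has_field_derivative 0) (at t)" if "t > 0" for t
    unfolding W_def using that
    by (auto intro!: derivative_eq_intros dp dp1 dD dH simp: field_simps p1_eq)
  obtain w where w: "W t = w" if "t > 0" for t
    using has_field_derivative_zero_constant[of "{0<..}" W] dW
    by (auto intro: has_field_derivative_at_within)
  have lim_p: "(p \<longlongrightarrow> 1) (at_right 0)" and lim_q: "(q \<longlongrightarrow> 0) (at_right 0)"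
    using DERIV_isCont[OF dp[of 0]] DERIV_isCont[OF dq[of 0]] p0 q0
    by (auto simp: isCont_def intro: tendsto_within_subset)
  have lim_p1: "(P \<longlongrightarrow> 0) (at_right 0)"
       and lim_q1: "(Q \<longlongrightarrow> 0) (at_right 0)"
    using DERIV_isCont[OF dp1[of 0]] DERIV_isCont[OF dq1[of 0]]
    by (auto simp: isCont_def P_def Q_def intro: tendsto_within_subset)
  have c1: "(p1 \<longlongrightarrow> p1 0) (at_right 0)"
  proof -
    have "isCont p1 0" unfolding p1_def
      by (rule DERIV_isCont[OF powser_has_field_derivative[OF entire_coeff_diffs[OF entire_bessel_coeff]]])
    thus ?thesis by (auto simp: isCont_def intro: tendsto_within_subset)
  qed
  have lnt: "((\<lambda>t::real. t * ln t) \<longlongrightarrow> 0) (at_right 0)" by real_asymp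
  have lim_lp1: "((\<lambda>t. (ln t + g) * P t) \<longlongrightarrow> 0) (at_right 0)"
  proof -
    have "((\<lambda>t. (t * ln t) * p1 t + g * P t) \<longlongrightarrow> 0 * p1 0 + g * 0) (at_right 0)"
      by (intro tendsto_intros c1 lnt lim_p1)
    thus ?thesis by (simp add: algebra_simps P_def)
  qed
  have lim_lp: "((\<lambda>t. (ln t + g) * (p t - 1)) \<longlongrightarrow> 0) (at_right 0)"
  proof -
    have "((\<lambda>t. (p t - 1) / t) \<longlongrightarrow> p1 0) (at_right 0)"
      using dp[of 0] p0 unfolding has_field_derivative_iff
      by (auto intro: tendsto_within_subset)
    hence "((\<lambda>t. (t * ln t) * ((p t - 1) / t) + g * (p t - 1)) \<longlongrightarrow> 0 * p1 0 + g * (1 - 1)) (at_right 0)"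
      by (intro tendsto_intros lnt lim_p)
    moreover have "eventually (\<lambda>t. (t * ln t) * ((p t - 1) / t) + g * (p t - 1) = (ln t + g) * (p t - 1)) (at_right 0)"
      unfolding eventually_at_filter by (auto simp: field_simps intro!: always_eventually)
    ultimately show ?thesis by (simp add: tendsto_cong)
  qed
  have lim_0: "((\<lambda>t. bessel_int 0 t - 1) \<longlongrightarrow> 0) (at_right 0)"
  proof (rule Lim_null_comparison)
    show "eventually (\<lambda>t. norm (bessel_int 0 t - 1) \<le> sqrt t * Gamma (1/2)) (at_right 0)"
      unfolding eventually_at_filter using bessel_int_0_bound by (auto intro!: always_eventually)
    show "((\<lambda>t. sqrt t * Gamma (1/2)) \<longlongrightarrow> 0) (at_right 0)"
      by (auto intro!: tendsto_eq_intros)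
  qed
  have lim_l0: "((\<lambda>t. ln t * (1 - bessel_int 0 t)) \<longlongrightarrow> 0) (at_right 0)"
  proof (rule Lim_null_comparison)
    show "eventually (\<lambda>t. norm (ln t * (1 - bessel_int 0 t)) \<le> \<bar>ln t * sqrt t\<bar> * Gamma (1/2)) (at_right 0)"
      unfolding eventually_at_filter
    proof (intro always_eventually allI impI)
      fix t :: real assume "t \<noteq> 0" "t \<in> {0<..}"
      hence t: "t > 0" by simp
      have "\<bar>ln t\<bar> * \<bar>bessel_int 0 t - 1\<bar> \<le> \<bar>ln t\<bar> * (sqrt t * Gamma (1/2))"
        by (intro mult_left_mono bessel_int_0_bound t) auto
      thus "norm (ln t * (1 - bessel_int 0 t)) \<le> \<bar>ln t * sqrt t\<bar> * Gamma (1/2)"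
        using t by (simp add: abs_mult abs_minus_commute mult_ac)
    qed
    have "((\<lambda>t::real. \<bar>ln t * sqrt t\<bar>) \<longlongrightarrow> 0) (at_right 0)" by real_asymp
    from tendsto_mult_left_zero[OF this]
    show "((\<lambda>t. \<bar>ln t * sqrt t\<bar> * Gamma (1/2)) \<longlongrightarrow> 0) (at_right 0)" .
  qed
  have lim_log: "((\<lambda>t. log_int t + euler_mascheroni) \<longlongrightarrow> 0) (at_right 0)"
  proof (rule Lim_null_comparison)
    show "eventually (\<lambda>t. norm (log_int t + euler_mascheroni) \<le>
            sqrt t * (Gamma (3/2) + 4 * Gamma (1/4))) (at_right 0)"
      unfolding eventually_at_filter using log_int_bound by (auto intro!: always_eventually)
    show "((\<lambda>t. sqrt t * (Gamma (3/2) + 4 * Gamma (1/4))) \<longlongrightarrow> 0) (at_right 0)"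
      by (auto intro!: tendsto_eq_intros)
  qed
  have lim_D: "(D \<longlongrightarrow> 0) (at_right 0)"
  proof -
    \<comment> \<open>This is \<open>D t\<close> rewritten by \<open>bessel_int_1_eq\<close>, with
      ln t added and subtracted so that each logarithm multiplies a factor vanishing at 0.\<close>
    have "((\<lambda>t. 2 * (log_int t + euler_mascheroni) + ln t * (1 - bessel_int 0 t)
              + (ln t + g) * (p t - 1) - 2 * q t) \<longlongrightarrow> 2 * 0 + 0 + 0 - 2 * 0) (at_right 0)"
      by (intro tendsto_intros lim_log lim_l0 lim_lp lim_q)
    moreover have "eventually (\<lambda>t. 2 * (log_int t + euler_mascheroni) + ln t * (1 - bessel_int 0 t)
              + (ln t + g) * (p t - 1) - 2 * q t = D t) (at_right 0)"
      unfolding eventually_at_filter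
      by (auto simp: D_def bessel_int_1_eq g_def algebra_simps simp del: One_nat_def
               intro!: always_eventually)
    ultimately show ?thesis by (simp add: tendsto_cong)
  qed
  have lim_H: "(H \<longlongrightarrow> 0) (at_right 0)"
  proof -
    have "((\<lambda>t. - (bessel_int 0 t - 1) + (p t - 1) + (ln t + g) * P t - 2 * Q t)
             \<longlongrightarrow> - 0 + (1 - 1) + 0 - 2 * 0) (at_right 0)"
      by (intro tendsto_intros lim_0 lim_p lim_lp1 lim_q1)
    thus ?thesis by (simp add: H_def)
  qed
  have "(W \<longlongrightarrow> 1 * 0 - 0 * 0) (at_right 0)"
    unfolding W_def by (intro tendsto_intros lim_p lim_H lim_p1 lim_D)
  moreover have "(W \<longlongrightarrow> w) (at_right 0)"
    by (rule Lim_transform_eventually[OF tendsto_const])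
       (auto simp: eventually_at_filter w intro!: always_eventually)
  ultimately have w0: "w = 0"
    using tendsto_unique[of "at_right (0::real)" W] by simp
  have "((\<lambda>t. D t / p t) has_field_derivative 0) (at t)" if t: "t > 0" for t
  proof -
    have "H t / t * p t - D t * p1 t = 0"
      using w[OF t] w0 t by (simp add: W_def P_def field_simps)
    thus ?thesis using t p_pos[OF t]
      by (auto intro!: derivative_eq_intros dp dD)
  qed
  then obtain d where d: "D t / p t = d" if "t > 0" for t
    using has_field_derivative_zero_constant[of "{0<..}" "\<lambda>t. D t / p t"]
    by (auto intro: has_field_derivative_at_within)
  have "((\<lambda>t. D t / p t) \<longlongrightarrow> 0 / 1) (at_right 0)"
    by (intro tendsto_intros lim_D lim_p) auto
  moreover have "((\<lambda>t. D t / p t) \<longlongrightarrow> d) (at_right 0)"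
    by (rule Lim_transform_eventually[OF tendsto_const])
       (auto simp: eventually_at_filter d intro!: always_eventually)
  ultimately have "d = 0"
    using tendsto_unique[of "at_right (0::real)" "\<lambda>t. D t / p t"] by simp
  hence "D y = 0" using d[OF assms] p_pos[OF assms] by simp
  thus ?thesis by (simp add: D_def p_def q_def g_def algebra_simps)
qed

subsection \<open>Decay of \<open>J\<^sub>0\<close>\<close>

text \<open>
  With \<open>\<phi> s = J\<^sub>0 (2 s)\<close> and \<open>\<psi> s = s \<phi>' s / 2\<close>, the energy \<open>E\<close> below satisfies \<open>E' = - \<phi> \<psi> / (2 s\<^sup>2)\<close>,
  because its last term cancels the derivative \<open>\<phi>\<^sup>2 - \<psi>\<^sup>2 / s\<^sup>2\<close> of the others. Hence
  \<open>\<bar>E'\<bar> \<le> E / (3 s\<^sup>2)\<close> and \<open>E\<close> stays bounded.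
\<close>
lemma bessel_series_decay_sqrt:
  "\<exists>C. \<forall>s\<ge>1. s * (powser bessel_coeff (- (s\<^sup>2)))\<^sup>2 \<le> (C::real)"
proof -
  define \<phi> where "\<phi> = (\<lambda>s::real. powser bessel_coeff (- (s\<^sup>2)))"
  define \<psi> where "\<psi> = (\<lambda>s::real. - (s\<^sup>2) * powser (diffs bessel_coeff) (- (s\<^sup>2)))"
  define Y where "Y = (\<lambda>s. s * (\<phi> s)\<^sup>2 + (\<psi> s)\<^sup>2 / s)"
  define E where "E = (\<lambda>s. Y s + \<phi> s * \<psi> s / (2 * s))"
  have d\<phi>: "(\<phi> has_field_derivative 2 * \<psi> s / s) (at s)" if "s > 0" for s
    unfolding \<phi>_def \<psi>_def
    by (rule powser_has_field_derivative_compose[OF entire_bessel_coeff, THEN DERIV_cong])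
       (use that in \<open>auto intro!: derivative_eq_intros simp: field_simps power2_eq_square\<close>)
  have d\<psi>: "(\<psi> has_field_derivative - 2 * s * \<phi> s) (at s)" for s
  proof -
    have "((\<lambda>s. - (s\<^sup>2)) has_field_derivative - 2 * s) (at s)"
      by (auto intro!: derivative_eq_intros)
    from DERIV_chain2[OF bessel_series_derivative this] show ?thesis
      unfolding \<phi>_def \<psi>_def by (simp add: mult_ac)
  qed
  have dE: "(E has_field_derivative - (\<phi> s * \<psi> s) / (2 * s\<^sup>2)) (at s)" if "s > 0" for s
    unfolding E_def Y_def using that
    by (auto intro!: derivative_eq_intros d\<phi> d\<psi> simp: field_simps power2_eq_square)
  have prod: "2 * \<bar>\<phi> s * \<psi> s\<bar> \<le> Y s" if s: "s > 0" for s
  proof -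
    have "0 \<le> (s * \<bar>\<phi> s\<bar> - \<bar>\<psi> s\<bar>)\<^sup>2 / s" using s by simp
    also have "\<dots> = Y s - 2 * \<bar>\<phi> s * \<psi> s\<bar>"
      using s by (simp add: Y_def power2_eq_square field_simps abs_mult)
    finally show ?thesis by simp
  qed
  \<comment> \<open>For s \<ge> 1 the mixed term of \<open>E\<close> is at most |\<phi> \<psi>| / 2,
    hence at most Y / 4.\<close>
  have lower: "3/4 * Y s \<le> E s" if s: "s \<ge> 1" for s
  proof -
    have "\<bar>\<phi> s * \<psi> s\<bar> / (2 * s) \<le> \<bar>\<phi> s * \<psi> s\<bar> / 2"
      using s by (intro divide_left_mono) auto
    moreover have "\<bar>\<phi> s * \<psi> s / (2 * s)\<bar> = \<bar>\<phi> s * \<psi> s\<bar> / (2 * s)"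
      using s by (simp add: abs_divide)
    moreover define X where "X = \<phi> s * \<psi> s / (2 * s)"
    moreover have "2 * \<bar>\<phi> s * \<psi> s\<bar> \<le> Y s" using prod[of s] s by simp
    ultimately have "3/4 * Y s \<le> Y s + X" by linarith
    thus ?thesis by (simp add: E_def X_def)
  qed
  \<comment> \<open>\<open>exp (1 / (3 * s))\<close> is the integrating factor for E' \<le> E / (3
    s^2). The 1/3 arises from |\<phi> \<psi>| / 2 \<le> Y / 4 \<le> E / 3.\<close>
  have dec: "E s * exp (1 / (3 * s)) \<le> E 1 * exp (1 / (3 * 1))" if s: "s \<ge> 1" for s
  proof (rule DERIV_nonpos_imp_nonincreasing[OF s])
    fix t :: real assume t: "1 \<le> t" "t \<le> s"
    have "- (\<phi> t * \<psi> t) / (2 * t\<^sup>2) \<le> E t / (3 * t\<^sup>2)"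
    proof -
      have "- (\<phi> t * \<psi> t) / 2 \<le> E t / 3"
        using prod[of t] lower[of t] t by linarith
      from divide_right_mono[OF this, of "t\<^sup>2"] show ?thesis by (simp add: field_simps)
    qed
    hence "(- (\<phi> t * \<psi> t) / (2 * t\<^sup>2) - E t / (3 * t\<^sup>2)) * exp (1 / (3 * t)) \<le> 0"
      by (intro mult_nonpos_nonneg) auto
    moreover have "((\<lambda>s. E s * exp (1 / (3 * s))) has_real_derivative
        (- (\<phi> t * \<psi> t) / (2 * t\<^sup>2) - E t / (3 * t\<^sup>2)) * exp (1 / (3 * t))) (at t)"
      using t by (auto intro!: derivative_eq_intros dE simp: field_simps power2_eq_square)
    ultimately show "\<exists>l. ((\<lambda>s. E s * exp (1 / (3 * s))) has_real_derivative l) (at t) \<and> l \<le> 0"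
      by blast
  qed
  have "s * (\<phi> s)\<^sup>2 \<le> 4/3 * (E 1 * exp (1 / 3))" if s: "s \<ge> 1" for s
  proof -
    have "s * (\<phi> s)\<^sup>2 \<le> Y s" "0 \<le> Y s" using s by (simp_all add: Y_def)
    moreover have "E s \<ge> 0" using \<open>0 \<le> Y s\<close> lower[OF s] by linarith
    hence "E s * 1 \<le> E s * exp (1 / (3 * s))" using s by (intro mult_left_mono) auto
    ultimately show ?thesis using lower[OF s] dec[OF s] by simp
  qed
  thus ?thesis unfolding \<phi>_def by blast
qed

lemma bessel_series_decay:
  "\<exists>C\<ge>0. \<forall>t\<ge>0. \<bar>powser bessel_coeff (- t)\<bar> \<le> C * (1 + t) powr (- 1 / 4 :: real)"
proof -
  obtain C where C: "s * (powser bessel_coeff (- (s\<^sup>2)))\<^sup>2 \<le> C" if "s \<ge> 1" for s :: real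
    using bessel_series_decay_sqrt by blast
  have "continuous_on {0..1} (\<lambda>t::real. powser bessel_coeff (- t))"
    by (intro continuous_on_powser entire_bessel_coeff continuous_intros)
  hence "bounded ((\<lambda>t::real. powser bessel_coeff (- t)) ` {0..1})"
    by (intro compact_imp_bounded compact_continuous_image) auto
  then obtain B where B: "\<forall>t\<in>{0..1::real}. \<bar>powser bessel_coeff (- t)\<bar> \<le> B"
    by (auto simp: bounded_iff)
  have B0: "B \<ge> 0" using B[rule_format, of 0] by simp
  have C0: "C \<ge> 0" using C[of 1] by (smt (verit) mult_1 zero_le_power2)
  \<comment> \<open>\<open>B\<close> covers [0, 1] by compactness and sqrt C the rest. The factor
    2^(1/4) pays for 1 + t \<le> 2 in the first range and 1 + t \<le> 2 t in the second.\<close>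
  define K where "K = 2 powr (1/4) * (B + sqrt C)"
  have "\<bar>powser bessel_coeff (- t)\<bar> \<le> K * (1 + t) powr (- 1 / 4)" if t: "t \<ge> 0" for t :: real
  proof (cases "t \<le> 1")
    case True
    have "1 = 2 powr (1/4) * (2::real) powr (-1/4)" by (simp add: powr_add[symmetric])
    also have "\<dots> \<le> 2 powr (1/4) * (1 + t) powr (-1/4)"
      using True t by (intro mult_left_mono powr_mono2') auto
    finally have "(B + sqrt C) * 1 \<le> (B + sqrt C) * (2 powr (1/4) * (1 + t) powr (-1/4))"
      using B0 C0 by (intro mult_left_mono) auto
    moreover have "\<bar>powser bessel_coeff (- t)\<bar> \<le> B + sqrt C"
      using B[rule_format, of t] True t C0 by (smt (verit) atLeastAtMost_iff real_sqrt_ge_zero)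
    ultimately show ?thesis unfolding K_def by (simp add: mult_ac)
  next
    case False
    define s where "s = sqrt t"
    have s: "s \<ge> 1" "s\<^sup>2 = t" using False by (auto simp: s_def)
    have "(powser bessel_coeff (- t))\<^sup>2 \<le> C / s" using C[of s] s by (simp add: field_simps)
    hence "\<bar>powser bessel_coeff (- t)\<bar> \<le> sqrt (C / s)" by (rule real_le_rsqrt[of "\<bar>_\<bar>", simplified])
    also have "\<dots> = sqrt C * t powr (-1/4)"
    proof -
      have "sqrt s = (t powr (1/2)) powr (1/2)" using False by (simp add: s_def powr_half_sqrt)
      also have "\<dots> = t powr (1/4)" by (simp add: powr_powr)
      finally show ?thesis using powr_minus_divide[of t "1/4"] by (simp add: real_sqrt_divide)
    qed
    also have "\<dots> \<le> sqrt C * ((1 + t) / 2) powr (-1/4)"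
      using False C0 by (intro mult_left_mono powr_mono2') auto
    also have "((1 + t) / 2) powr (-1/4) = 2 powr (1/4) * (1 + t) powr (-1/4)"
      using t powr_minus_divide[of "2::real" "1/4"] by (simp add: powr_divide)
    also have "sqrt C * (2 powr (1/4) * (1 + t) powr (-1/4)) \<le> K * (1 + t) powr (-1/4)"
      unfolding K_def using B0 by (simp add: algebra_simps)
    finally show ?thesis .
  qed
  moreover have "K \<ge> 0" using B0 C0 by (simp add: K_def)
  ultimately show ?thesis by blast
qed

subsection \<open>The Laplace transform of \<open>J\<^sub>0\<close>\<close>

lemma integral_power_exp:
  fixes a :: real
  assumes a: "a > 0"
  shows "(\<lambda>v. v ^ k * exp (- a * v)) absolutely_integrable_on {0<..}"
    and "integral {0<..} (\<lambda>v. v ^ k * exp (- a * v)) = fact k / a ^ Suc k"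
proof -
  let ?f = "\<lambda>b::real. b ^ k * exp (- b)"
  have "((\<lambda>t::real. t powr (real (Suc k) - 1) / exp t) has_integral Gamma (real (Suc k))) {0<..}"
    by (rule Gamma_integral_real_Ioi) simp
  also have "Gamma (real (Suc k)) = fact k"
    using Gamma_fact[of k, where 'a = real] by (simp add: add_ac)
  finally have "(?f has_integral fact k) {0<..}"
    by (rule has_integral_eq[rotated]) (auto simp: powr_realpow exp_minus divide_inverse)
  moreover have img: "(\<lambda>v. a * v) ` {0<..} = {0<..}"
  proof safe
    fix x :: real assume "x > 0"
    thus "x \<in> (\<lambda>v. a * v) ` {0<..}" using a
      by (intro image_eqI[of _ _ "x / a"]) auto
  qed (use a in auto)
  ultimately have *: "?f absolutely_integrable_on ((\<lambda>v. a * v) ` {0<..})"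
    "integral ((\<lambda>v. a * v) ` {0<..}) ?f = fact k"
    by (auto simp: has_integral_iff intro!: nonnegative_absolutely_integrable_1)
  have "(\<lambda>x. \<bar>a\<bar> * ?f (a * x)) absolutely_integrable_on {0<..} \<and>
           integral {0<..} (\<lambda>x. \<bar>a\<bar> * ?f (a * x)) = fact k
     \<longleftrightarrow> ?f absolutely_integrable_on ((\<lambda>v. a * v) ` {0<..}) \<and>
         integral ((\<lambda>v. a * v) ` {0<..}) ?f = fact k"
    by (rule has_absolute_integral_change_of_variables_1')
       (use a in \<open>auto intro!: derivative_eq_intros simp: inj_on_def\<close>)
  with * have 1: "(\<lambda>x. \<bar>a\<bar> * ?f (a * x)) absolutely_integrable_on {0<..}"
    and 2: "integral {0<..} (\<lambda>x. \<bar>a\<bar> * ?f (a * x)) = fact k" by auto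
  have eq: "\<bar>a\<bar> * ?f (a * x) = a ^ Suc k * (x ^ k * exp (- a * x))" for x
    using a by (simp add: power_mult_distrib)
  have "inverse (a ^ Suc k) * (a ^ Suc k * z) = z" for z using a by (simp add: field_simps)
  thus "(\<lambda>v. v ^ k * exp (- a * v)) absolutely_integrable_on {0<..}"
    using set_integrable_mult_right[OF 1[unfolded eq], of "inverse (a ^ Suc k)"] by (simp only:)
  show "integral {0<..} (\<lambda>v. v ^ k * exp (- a * v)) = fact k / a ^ Suc k"
    using 2 a unfolding eq integral_mult_right by (simp add: field_simps)
qed

text \<open>The transform of v^k is k! / a^(k+1), which cancels one of the two factorials and leaves
  an exponential series. The integrals of the absolute values sum to exp(|y| / a) / a, which
  justifies the exchange.\<close>

lemma bessel_series_Laplace: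
  fixes a y :: real
  assumes a: "a > 0"
  shows "(\<integral>v. indicator {0<..} v * (powser bessel_coeff (- (v * y)) * exp (- a * v)) \<partial>lborel)
            = exp (- y / a) / a"
proof -
  define f where "f = (\<lambda>k v. bessel_coeff k * (- y) ^ k * (indicator {0<..} v * (v ^ k * exp (- a * v))))"
  have int: "set_integrable lborel {0<..} (\<lambda>v. v ^ k * exp (- a * v))" for k
    by (rule set_integrable_lborel_Ioi[OF integral_power_exp(1)[OF a]]) (intro continuous_intros)
  hence int': "integrable lborel (\<lambda>v. indicator {0<..} v * (v ^ k * exp (- a * v)))" for k
    by (simp add: set_integrable_def)
  have val: "(\<integral>v. indicator {0<..} v * (v ^ k * exp (- a * v)) \<partial>lborel) = fact k / a ^ Suc k" for k
    using set_borel_integral_eq_integral(2)[OF int[of k]] integral_power_exp(2)[OF a, of k]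
    by (simp add: set_lebesgue_integral_def)
  have sm: "summable (\<lambda>k. bessel_coeff k * t ^ k)" for t :: real
    using entire_bessel_coeff[where 'a = real] by (simp add: entire_coeff_def)
  have "(\<lambda>k. \<integral>v. f k v \<partial>lborel) sums (\<integral>v. (\<Sum>k. f k v) \<partial>lborel)"
  proof (rule sums_integral)
    show "integrable lborel (f k)" for k
      unfolding f_def by (intro integrable_mult_right int')
    show "AE v in lborel. summable (\<lambda>k. norm (f k v))"
    proof (rule AE_I2)
      fix v :: real
      have "summable (\<lambda>k. indicator {0<..} v * exp (- a * v) * (bessel_coeff k * \<bar>y * v\<bar> ^ k))"
        by (intro summable_mult sm)
      moreover have "norm (f k v) = indicator {0<..} v * exp (- a * v) * (bessel_coeff k * \<bar>y * v\<bar> ^ k)" for k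
        by (simp add: f_def abs_mult power_abs[symmetric] power_mult_distrib bessel_coeff_def
                 split: split_indicator)
      ultimately show "summable (\<lambda>k. norm (f k v))" by simp
    qed
    have "summable (\<lambda>k. (\<bar>y\<bar> / a) ^ k /\<^sub>R fact k)" by (rule summable_exp_generic)
    hence "summable (\<lambda>k. 1 / a * ((\<bar>y\<bar> / a) ^ k /\<^sub>R fact k))" by (rule summable_mult)
    moreover have "(\<integral>v. norm (f k v) \<partial>lborel) = 1 / a * ((\<bar>y\<bar> / a) ^ k /\<^sub>R fact k)" for k
    proof -
      have "norm (f k v) = bessel_coeff k * \<bar>y\<bar> ^ k * (indicator {0<..} v * (v ^ k * exp (- a * v)))" for v
        by (simp add: f_def abs_mult power_abs bessel_coeff_def split: split_indicator)
      hence "(\<integral>v. norm (f k v) \<partial>lborel) = bessel_coeff k * \<bar>y\<bar> ^ k * (fact k / a ^ Suc k)"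
        using val[of k] by simp
      also have "\<dots> = 1 / a * ((\<bar>y\<bar> / a) ^ k /\<^sub>R fact k)"
        using a by (simp add: bessel_coeff_def power2_eq_square power_divide field_simps)
      finally show ?thesis .
    qed
    ultimately show "summable (\<lambda>k. \<integral>v. norm (f k v) \<partial>lborel)" by simp
  qed
  moreover have "(\<integral>v. f k v \<partial>lborel) = 1 / a * ((- y / a) ^ k /\<^sub>R fact k)" for k
  proof -
    have "(\<integral>v. f k v \<partial>lborel) = bessel_coeff k * (- y) ^ k * (fact k / a ^ Suc k)"
      unfolding f_def using val[of k] by simp
    also have "\<dots> = 1 / a * ((- y / a) ^ k /\<^sub>R fact k)"
      unfolding power_divide using a by (simp add: bessel_coeff_def power2_eq_square field_simps)
    finally show ?thesis .
  qed
  moreover have "(\<lambda>k. 1 / a * ((- y / a) ^ k /\<^sub>R fact k)) sums (1 / a * exp (- y / a))"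
    by (intro sums_mult exp_converges)
  moreover have "(\<Sum>k. f k v) =
      indicator {0<..} v * (powser bessel_coeff (- (v * y)) * exp (- a * v))" for v
  proof -
    have "(\<lambda>k. indicator {0<..} v * exp (- a * v) * (bessel_coeff k * (- (v * y)) ^ k)) sums
            (indicator {0<..} v * exp (- a * v) * powser bessel_coeff (- (v * y)))"
      unfolding powser_def by (intro sums_mult summable_sums sm)
    moreover have "indicator {0<..} v * exp (- a * v) * (bessel_coeff k * (- (v * y)) ^ k) = f k v" for k
      using power_mult_distrib[of "- y" v k] by (simp add: f_def mult_ac)
    ultimately show ?thesis by (simp add: sums_iff mult_ac)
  qed
  ultimately show ?thesis using sums_unique2 by force
qed

lemma integrable_one_plus_powr:
  "(\<lambda>v::real. (1 + v) powr (- 5 / 4)) integrable_on {0<..}"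
proof -
  have int: "((\<lambda>v. (1 + v) powr (- 5 / 4)) has_integral
        - 4 * (1 + b) powr (- 1 / 4) - (- 4 * (1 + 0) powr (- 1 / 4))) {0..b}" if "b \<ge> 0" for b :: real
    by (rule fundamental_theorem_of_calculus)
       (use that in \<open>auto intro!: derivative_eq_intros
          simp: has_real_derivative_iff_has_vector_derivative[symmetric]\<close>)
  have "((\<lambda>v::real. (1 + v) powr (- 5 / 4)) has_integral 4) {0..}"
  proof (rule has_integral_to_inf)
    show "(\<lambda>v::real. (1 + v) powr (- 5 / 4)) integrable_on {0..b}" for b
      using int[of b] by (cases "b \<ge> 0") (auto simp: integrable_on_def)
    have "((\<lambda>b::real. - 4 * (1 + b) powr (- 1 / 4) + 4) \<longlongrightarrow> 4) at_top" by real_asymp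
    moreover have "eventually (\<lambda>b::real. - 4 * (1 + b) powr (- 1 / 4) + 4 =
          integral {0..b} (\<lambda>v. (1 + v) powr (- 5 / 4))) at_top"
      using eventually_ge_at_top[of 0]
      by eventually_elim (use int in \<open>auto simp: has_integral_iff\<close>)
    ultimately show "((\<lambda>b::real. integral {0..b} (\<lambda>v. (1 + v) powr (- 5 / 4))) \<longlongrightarrow> 4) at_top"
      by (rule Lim_transform_eventually)
  qed auto
  thus ?thesis by (auto simp: has_integral_Ici_iff_Ioi integrable_on_def)
qed

lemma bessel_quotient_absolutely_integrable:
  fixes y :: real
  assumes y: "y > 0"
  shows "(\<lambda>v. powser bessel_coeff (- (v * y)) / (1 + v)) absolutely_integrable_on {0<..}"
proof -
  obtain C where C: "C \<ge> 0"
    "\<And>t. t \<ge> 0 \<Longrightarrow> \<bar>powser bessel_coeff (- t)\<bar> \<le> C * (1 + t) powr (- 1 / 4 :: real)"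
    using bessel_series_decay by blast
  \<comment> \<open>Chosen so that m (1 + v) \<le> 1 + v y, which turns decay in v y into decay in
    v.\<close>
  define m where "m = min 1 y"
  have m: "m > 0" "m \<le> 1" "m \<le> y" using y by (auto simp: m_def)
  show ?thesis
  proof (rule absolutely_integrable_Ioi_dominated)
    show "continuous_on {0<..} (\<lambda>v. powser bessel_coeff (- (v * y)) / (1 + v))"
      by (intro continuous_intros continuous_on_powser entire_bessel_coeff) auto
    show "(\<lambda>v. C * m powr (- 1 / 4) * (1 + v) powr (- 5 / 4)) integrable_on {0<..}"
      by (intro integrable_on_mult_right integrable_one_plus_powr)
    fix v :: real assume v: "v > 0"
    have "m * v \<le> y * v" using m v by (intro mult_right_mono) auto
    hence "m * (1 + v) \<le> 1 + v * y"
      using m(2) by (simp add: distrib_left mult.commute[of v y])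
    hence "(1 + v * y) powr (- 1 / 4) \<le> (m * (1 + v)) powr (- 1 / 4)"
      using m v by (intro powr_mono2') auto
    also have "\<dots> = m powr (- 1 / 4) * (1 + v) powr (- 1 / 4)"
      using m v by (simp add: powr_mult)
    finally have "\<bar>powser bessel_coeff (- (v * y))\<bar> \<le> C * (m powr (- 1 / 4) * (1 + v) powr (- 1 / 4))"
      using C(2)[of "v * y"] C(1) v y by (meson mult_left_mono mult_nonneg_nonneg order_trans less_imp_le)
    hence "\<bar>powser bessel_coeff (- (v * y))\<bar> / (1 + v) \<le> C * (m powr (- 1 / 4) * (1 + v) powr (- 1 / 4)) / (1 + v)"
      using v by (intro divide_right_mono) auto
    also have "\<dots> = C * m powr (- 1 / 4) * ((1 + v) powr (- 1 / 4) / (1 + v))" by simp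
    also have "(1 + v) powr (- 1 / 4) / (1 + v) = (1 + v) powr (- 5 / 4)"
      using powr_diff[of "1 + v" "- 1 / 4" 1] v by simp
    finally show "\<bar>powser bessel_coeff (- (v * y)) / (1 + v)\<bar> \<le> C * m powr (- 1 / 4) * (1 + v) powr (- 5 / 4)"
      using v by (simp add: abs_divide)
  qed
qed

text \<open>
  Fubini's theorem after writing \<open>1 / (1 + v)\<close> as the integral of \<open>exp (- a (1 + v))\<close> over \<open>a > 0\<close>.
\<close>
lemma bessel_quotient_integral:
  fixes y :: real
  assumes y: "y > 0"
  shows "integral {0<..} (\<lambda>v. powser bessel_coeff (- (v * y)) / (1 + v)) = bessel_int 1 y"
proof -
  define j where "j = (\<lambda>v. powser bessel_coeff (- (v * y)))"
  define F where "F = (\<lambda>v a. (indicator {0<..} v * j v) * (indicator {0<..} a * exp (- (1 + v) * a)))"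
  have cont_j: "continuous_on A j" for A
    unfolding j_def by (intro continuous_intros continuous_on_powser entire_bessel_coeff)
  have [measurable]: "j \<in> borel_measurable borel"
    by (rule borel_measurable_continuous_onI[OF cont_j])
  have si: "set_integrable lborel {0<..} (\<lambda>v. j v / (1 + v))"
    unfolding j_def
    by (rule set_integrable_lborel_Ioi[OF bessel_quotient_absolutely_integrable[OF y]])
       (intro continuous_intros continuous_on_powser entire_bessel_coeff; auto)
  have exp_int: "integrable lborel (\<lambda>a. indicator {0<..} a * exp (- c * a))"
       "(\<integral>a. indicator {0<..} a * exp (- c * a) \<partial>lborel) = 1 / c" if c: "c > 0" for c :: real
  proof -
    have s: "set_integrable lborel {0<..} (\<lambda>v. v ^ 0 * exp (- c * v))"
      by (rule set_integrable_lborel_Ioi[OF integral_power_exp(1)[OF c]]) (intro continuous_intros)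
    thus "integrable lborel (\<lambda>a. indicator {0<..} a * exp (- c * a))"
      by (simp add: set_integrable_def)
    show "(\<integral>a. indicator {0<..} a * exp (- c * a) \<partial>lborel) = 1 / c"
      using set_borel_integral_eq_integral(2)[OF s] integral_power_exp(2)[OF c, of 0]
      by (simp add: set_lebesgue_integral_def)
  qed
  have F_a: "(\<integral>a. F v a \<partial>lborel) = indicator {0<..} v * (j v / (1 + v))" for v
    unfolding F_def using exp_int[of "1 + v"] by (cases "v > 0") simp_all
  have norm_F_a: "(\<integral>a. norm (F v a) \<partial>lborel) = norm (indicator {0<..} v * (j v / (1 + v)))" for v
  proof (cases "v > 0")
    case True
    have "norm (F v a) = \<bar>j v\<bar> * (indicator {0<..} a * exp (- (1 + v) * a))" for a
      using True by (simp add: F_def abs_mult)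
    thus ?thesis using True exp_int(2)[of "1 + v"] by (simp add: abs_divide)
  qed (simp add: F_def)
  \<comment> \<open>Integrating the norm over a first leaves |j v| / (1 + v); its integrability is
    exactly where the decay of J_0 enters.\<close>
  have "integrable (lborel \<Otimes>\<^sub>M lborel) (case_prod F)"
  proof (rule lborel_pair.Fubini_integrable)
    show "case_prod F \<in> borel_measurable (lborel \<Otimes>\<^sub>M lborel)"
      unfolding F_def by measurable
    have "integrable lborel (\<lambda>v. norm (indicator {0<..} v * (j v / (1 + v))))"
      using si by (intro integrable_norm) (simp add: set_integrable_def)
    thus "integrable lborel (\<lambda>v. \<integral>a. norm (case_prod F (v, a)) \<partial>lborel)"
      unfolding prod.case norm_F_a .
    show "AE v in lborel. integrable lborel (\<lambda>a. case_prod F (v, a))"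
    proof (rule AE_I2)
      fix v :: real
      show "integrable lborel (\<lambda>a. case_prod F (v, a))"
        using exp_int(1)[of "1 + v"] by (cases "v > 0") (auto simp: F_def)
    qed
  qed
  note Fubini = lborel_pair.Fubini_integral[OF this]
  have F_v: "(\<integral>v. F v a \<partial>lborel) = indicator {0<..} a * (exp (- a - y / a) / a ^ 1)" for a
  proof (cases "a > 0")
    case True
    have "F v a = exp (- a) * (indicator {0<..} v * (powser bessel_coeff (- (v * y)) * exp (- a * v)))" for v
      using True by (simp add: F_def j_def algebra_simps exp_add[symmetric])
    hence "(\<integral>v. F v a \<partial>lborel) = exp (- a) * (exp (- y / a) / a)"
      using bessel_series_Laplace[OF True, of y] by simp
    thus ?thesis using True by (simp add: exp_add[symmetric])
  qed (simp add: F_def)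
  have "bessel_int 1 y = (\<integral>a. indicator {0<..} a * (exp (- a - y / a) / a ^ 1) \<partial>lborel)"
    using set_borel_integral_eq_integral(2)[OF set_integrable_lborel_Ioi[OF
        bessel_integrand_absolutely_integrable[OF y, of 1] continuous_bessel_integrand]]
    by (simp add: set_lebesgue_integral_def bessel_int_def)
  also have "\<dots> = (\<integral>v. (\<integral>a. F v a \<partial>lborel) \<partial>lborel)"
    using Fubini unfolding F_v .
  also have "\<dots> = integral {0<..} (\<lambda>v. j v / (1 + v))"
    using set_borel_integral_eq_integral(2)[OF si] by (simp add: F_a set_lebesgue_integral_def)
  finally show ?thesis by (simp add: j_def)
qed

subsection \<open>The logarithmic integral of \<open>J\<^sub>1\<close>\<close>

text \<open>With only conditional convergence at hand, the definition of the integral over an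
  unbounded set is used directly: an interval around a large ball meets \<open>{a..}\<close> in some
  \<open>{a..d}\<close> with d large, where the integral is \<open>V d\<close>.\<close>

lemma has_integral_improper_Ici:
  fixes f :: "real \<Rightarrow> 'a::euclidean_space"
  assumes V: "\<And>b. b \<ge> a \<Longrightarrow> (f has_integral V b) {a..b}" and lim: "(V \<longlongrightarrow> L) at_top"
  shows "(f has_integral L) {a..}"
proof -
  have not_cbox: "\<nexists>c d. {a..} = cbox c d"
  proof safe
    fix c d :: real assume eq: "{a..} = cbox c d"
    have "max a d + 1 \<in> {a..}" by (simp add: max_def)
    hence "max a d + 1 \<le> d" unfolding eq by simp
    thus False by (simp add: max_def split: if_splits)
  qed
  have approx: "\<exists>B>0. \<forall>c d. ball 0 B \<subseteq> cbox c d \<longrightarrow>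
      (\<exists>z. ((\<lambda>x. if x \<in> {a..} then f x else 0) has_integral z) (cbox c d) \<and> norm (z - L) < e)"
    if "e > 0" for e
  proof -
    from tendstoD[OF lim \<open>e > 0\<close>] obtain b0 where b0: "\<And>b. b \<ge> b0 \<Longrightarrow> norm (V b - L) < e"
      unfolding dist_norm eventually_at_top_linorder by auto
    define B where "B = \<bar>a\<bar> + \<bar>b0\<bar> + 1"
    show ?thesis
    proof (intro exI[of _ B] conjI allI impI)
      fix c d :: real assume sub: "ball 0 B \<subseteq> cbox c d"
      have "{- B<..<B} \<subseteq> {c..d}" using sub by (auto simp: subset_iff dist_real_def abs_less_iff)
      moreover have "- (B - 1 / 2) \<in> {- B<..<B}" "B - 1 / 2 \<in> {- B<..<B}" by (auto simp: B_def)
      ultimately have "- (B - 1 / 2) \<in> {c..d}" "B - 1 / 2 \<in> {c..d}" by blast+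
      hence cd: "c \<le> a" "a \<le> d" "b0 \<le> d" by (auto simp: B_def)
      have "((\<lambda>x. if x \<in> {a..d} then f x else 0) has_integral V d) {c..d}"
        using V[of d] cd by (subst has_integral_restrict) auto
      hence "((\<lambda>x. if x \<in> {a..} then f x else 0) has_integral V d) {c..d}"
        by (rule has_integral_eq[rotated]) auto
      thus "\<exists>z. ((\<lambda>x. if x \<in> {a..} then f x else 0) has_integral z) (cbox c d) \<and> norm (z - L) < e"
        using b0[OF cd(3)] by auto
    qed (simp add: B_def)
  qed
  show ?thesis
    by (subst has_integral_alt, subst if_not_P, rule not_cbox, intro allI impI, rule approx)
qed

text \<open>The case x = 0 is included, since the integration over c starts there:
  \<open>0 powr 1 = 0\<close> agrees with the factor x / 2.\<close>

lemma Bessel_J_1_of_real: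
  "Bessel_J 1 (of_real x) = of_real (x / 2 * powser (diffs bessel_coeff) (- ((x / 2)\<^sup>2)))"
proof -
  have coeff: "(-1) ^ k * rGamma (1 + of_nat k + 1) / fact k * (complex_of_real x / 2) ^ (2 * k) =
          diffs bessel_coeff k * (- ((complex_of_real x / 2)\<^sup>2)) ^ k" for k
  proof -
    have "rGamma (1 + of_nat k + 1 :: complex) = inverse (fact (Suc k))"
      using Gamma_fact[of "Suc k", where 'a = complex] by (simp add: rGamma_inverse_Gamma add_ac)
    moreover have "(- ((complex_of_real x / 2)\<^sup>2)) ^ k = (-1) ^ k * (complex_of_real x / 2) ^ (2 * k)"
      by (subst power_minus) (simp add: power_mult)
    ultimately show ?thesis by (simp only: diffs_bessel_coeff) (simp add: field_simps)
  qed
  have c: "diffs bessel_coeff = (\<lambda>k. complex_of_real (diffs bessel_coeff k))"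
    by (simp add: fun_eq_iff diffs_bessel_coeff)
  have "Bessel_J 1 (of_real x) = of_real x / 2 * powser (diffs bessel_coeff) (of_real (- ((x / 2)\<^sup>2)))"
  proof -
    have "(complex_of_real x / 2) powr 1 = of_real x / 2" by simp
    moreover have "- ((complex_of_real x / 2)\<^sup>2) = of_real (- ((x / 2)\<^sup>2))" by simp
    ultimately show ?thesis unfolding Bessel_J_def coeff powser_def by (simp only:)
  qed
  also have "powser (diffs bessel_coeff) (of_real (- ((x / 2)\<^sup>2))) =
      complex_of_real (powser (diffs bessel_coeff) (- ((x / 2)\<^sup>2)))"
    using powser_of_real[OF entire_coeff_diffs[OF entire_bessel_coeff], where 'a = complex, of "- ((x / 2)\<^sup>2)"]
    unfolding c[symmetric] .
  finally show ?thesis by simp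
qed

text \<open>As ln (x^2 / 4) = 2 ln (x / 2), twice the formula of \<open>Bessel_K_0_series\<close>
  matches \<open>bessel_int_1_series\<close> term by term.\<close>

lemma Bessel_K_0_of_real:
  assumes x: "x > 0"
  shows "2 * Bessel_K 0 (of_real x) = of_real (bessel_int 1 (x\<^sup>2 / 4))"
proof -
  have "of_real x \<notin> \<real>\<^sub>\<le>\<^sub>0" using x by (simp add: complex_nonpos_Reals_iff)
  note K = Bessel_K_0_series[OF this]
  have l: "Ln (of_real x / 2) = of_real (ln (x / 2))" using Ln_of_real[of "x / 2"] x by simp
  have s: "(complex_of_real x / 2)\<^sup>2 = of_real (x\<^sup>2 / 4)" by (simp add: power2_eq_square)
  have p: "powser bessel_coeff (complex_of_real t) = of_real (powser bessel_coeff t)"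
       "powser bessel_harm_coeff (complex_of_real t) = of_real (powser bessel_harm_coeff t)" for t
    using powser_of_real[OF entire_bessel_coeff[where 'a = real], where 'a = complex, of t]
      powser_of_real[OF entire_bessel_harm_coeff[where 'a = real], where 'a = complex, of t]
    unfolding bessel_coeff_of_real[where 'a = complex, symmetric]
      bessel_harm_coeff_of_real[where 'a = complex, symmetric] .
  have "ln (x\<^sup>2 / 4) = 2 * ln (x / 2)"
    using ln_realpow[of "x / 2" 2] x by (simp add: power2_eq_square)
  hence eq: "bessel_int 1 (x\<^sup>2 / 4) = - (2 * ln (x / 2) + 2 * euler_mascheroni) *
      powser bessel_coeff (x\<^sup>2 / 4) + 2 * powser bessel_harm_coeff (x\<^sup>2 / 4)"
    using bessel_int_1_series[of "x\<^sup>2 / 4"] x by simp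
  show ?thesis unfolding K l s p eq by (simp add: algebra_simps)
qed

lemma bessel_quotient_partial_integral_tendsto:
  fixes y :: real
  assumes y: "y > 0"
  shows "((\<lambda>w. integral {0..w} (\<lambda>v. powser bessel_coeff (- (v * y)) / (1 + v))) \<longlongrightarrow> bessel_int 1 y) at_top"
proof -
  let ?k = "\<lambda>v. powser bessel_coeff (- (v * y)) / (1 + v)"
  have ai: "?k absolutely_integrable_on {0..}"
    using bessel_quotient_absolutely_integrable[OF y]
    by (subst absolutely_integrable_spike_set_eq[of _ "{0<..}"])
       (auto intro!: negligible_subset[OF negligible_sing[of 0]])
  have "integral {0..} ?k = integral {0<..} ?k"
    by (intro integral_spike_set negligible_subset[OF negligible_sing[of 0]]) auto
  hence "(LINT v:{0..}|lebesgue. ?k v) = bessel_int 1 y"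
    using set_lebesgue_integral_eq_integral(2)[OF ai] bessel_quotient_integral[OF y] by simp
  moreover have "(LINT v:{0..w}|lebesgue. ?k v) = integral {0..w} ?k" for w
    by (intro set_lebesgue_integral_eq_integral set_integrable_subset[OF ai]) auto
  ultimately show ?thesis
    using tendsto_set_lebesgue_integral_at_top[OF _ ai] by simp
qed

text \<open>
  Integration by parts, using \<open>J\<^sub>1 (c x) = - (1 / x) \<partial>\<^sub>c J\<^sub>0 (c x)\<close>, followed by the substitution \<open>v = c\<^sup>2\<close>.
\<close>
lemma bessel_log_partial_integral:
  fixes x b :: real
  assumes x: "x > 0" and b: "b \<ge> 0"
  defines "y \<equiv> x\<^sup>2 / 4"
  shows "((\<lambda>c. c * x / 2 * powser (diffs bessel_coeff) (- ((c * x / 2)\<^sup>2)) * ln (1 + c\<^sup>2)) has_integral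
           (integral {0..b\<^sup>2} (\<lambda>v. powser bessel_coeff (- (v * y)) / (1 + v))
             - powser bessel_coeff (- (b\<^sup>2 * y)) * ln (1 + b\<^sup>2)) / x) {0..b}"
proof -
  define k where "k = (\<lambda>v. powser bessel_coeff (- (v * y)) / (1 + v))"
  define U where "U = (\<lambda>w. integral {0..w} k)"
  \<comment> \<open>The antiderivative, with V 0 = 0. The derivative 2 c k(c^2) of
    \<open>U (c\<^sup>2)\<close> cancels the term in which the product rule differentiates the
    logarithm.\<close>
  define V where "V = (\<lambda>b. (U (b\<^sup>2) - powser bessel_coeff (- (b\<^sup>2 * y)) * ln (1 + b\<^sup>2)) / x)"
  have cont_k: "continuous_on {0..w} k" for w
    unfolding k_def by (intro continuous_intros continuous_on_powser entire_bessel_coeff) auto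
  have pos: "1 + c\<^sup>2 \<noteq> 0" for c :: real using zero_le_power2[of c] by linarith
  have "((\<lambda>c. c * x / 2 * powser (diffs bessel_coeff) (- ((c * x / 2)\<^sup>2)) * ln (1 + c\<^sup>2)) has_integral
            V b - V 0) {0..b}"
  proof (rule fundamental_theorem_of_calculus_interior[OF b])
    have "continuous_on {0..b\<^sup>2} U"
      unfolding U_def by (intro indefinite_integral_continuous_1 integrable_continuous_interval cont_k)
    hence "continuous_on {0..b} (\<lambda>c. U (c\<^sup>2))"
      by (rule continuous_on_compose2) (auto intro!: continuous_intros power_mono)
    thus "continuous_on {0..b} V"
      unfolding V_def using x pos
      by (intro continuous_intros continuous_on_powser entire_bessel_coeff) auto
    fix c assume "c \<in> {0<..<b}"
    hence c: "c > 0" "c < b" by auto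
    have c2: "c\<^sup>2 < b\<^sup>2" using c by (intro power_strict_mono) auto
    have "(U has_real_derivative k (c\<^sup>2)) (at (c\<^sup>2) within {0..b\<^sup>2})"
      unfolding U_def using c2 by (intro integral_has_real_derivative cont_k) auto
    moreover have "at (c\<^sup>2) within {0..b\<^sup>2} = at (c\<^sup>2)"
      using c c2 by (intro at_within_interior) auto
    ultimately have dU: "(U has_real_derivative k (c\<^sup>2)) (at (c\<^sup>2))" by simp
    have "((\<lambda>c. c\<^sup>2) has_real_derivative 2 * c) (at c)"
      by (auto intro!: derivative_eq_intros)
    note dU' = DERIV_chain2[OF dU this]
    have "((\<lambda>c. - (c\<^sup>2 * y)) has_real_derivative - 2 * c * y) (at c)"
      by (auto intro!: derivative_eq_intros)
    note dp = powser_has_field_derivative_compose[OF entire_bessel_coeff this]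
    have dl: "((\<lambda>c. ln (1 + c\<^sup>2)) has_real_derivative 2 * c / (1 + c\<^sup>2)) (at c)"
      using c by (auto intro!: derivative_eq_intros add_pos_pos simp: field_simps)
    have "(V has_real_derivative (k (c\<^sup>2) * (2 * c) -
            (powser (diffs bessel_coeff) (- (c\<^sup>2 * y)) * (- 2 * c * y) * ln (1 + c\<^sup>2)
              + 2 * c / (1 + c\<^sup>2) * powser bessel_coeff (- (c\<^sup>2 * y)))) / x) (at c)"
      unfolding V_def by (intro DERIV_cdivide DERIV_diff DERIV_mult dU' dp dl)
    also have "(k (c\<^sup>2) * (2 * c) -
            (powser (diffs bessel_coeff) (- (c\<^sup>2 * y)) * (- 2 * c * y) * ln (1 + c\<^sup>2)
              + 2 * c / (1 + c\<^sup>2) * powser bessel_coeff (- (c\<^sup>2 * y)))) / x =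
          c * x / 2 * powser (diffs bessel_coeff) (- ((c * x / 2)\<^sup>2)) * ln (1 + c\<^sup>2)"
    proof -
      have "(c * x / 2)\<^sup>2 = c\<^sup>2 * y" by (simp add: y_def power2_eq_square)
      moreover have "k (c\<^sup>2) * (2 * c) = 2 * c / (1 + c\<^sup>2) * powser bessel_coeff (- (c\<^sup>2 * y))"
        by (simp add: k_def)
      moreover have "- 2 * c * y = - (c * x / 2) * x" by (simp add: y_def power2_eq_square)
      ultimately show ?thesis using x by (simp only:) (simp add: field_simps)
    qed
    finally show "(V has_vector_derivative
        c * x / 2 * powser (diffs bessel_coeff) (- ((c * x / 2)\<^sup>2)) * ln (1 + c\<^sup>2)) (at c)"
      by (simp add: has_real_derivative_iff_has_vector_derivative)
  qed
  thus ?thesis by (simp add: V_def U_def k_def)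
qed

lemma bessel_log_integral:
  assumes x: "x > 0"
  shows "((\<lambda>c. c * x / 2 * powser (diffs bessel_coeff) (- ((c * x / 2)\<^sup>2)) * ln (1 + c\<^sup>2)) has_integral
            bessel_int 1 (x\<^sup>2 / 4) / x) {0..}"
proof (rule has_integral_improper_Ici)
  define y where "y = x\<^sup>2 / 4"
  have y: "y > 0" using x by (simp add: y_def)
  obtain C where C: "C \<ge> 0"
    "\<And>t. t \<ge> 0 \<Longrightarrow> \<bar>powser bessel_coeff (- t)\<bar> \<le> C * (1 + t) powr (- 1 / 4 :: real)"
    using bessel_series_decay by blast
  have boundary: "((\<lambda>b. powser bessel_coeff (- (b\<^sup>2 * y)) * ln (1 + b\<^sup>2)) \<longlongrightarrow> 0) at_top"
  proof (rule Lim_null_comparison)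
    show "eventually (\<lambda>b. norm (powser bessel_coeff (- (b\<^sup>2 * y)) * ln (1 + b\<^sup>2)) \<le>
            C * ((1 + b\<^sup>2 * y) powr (- 1 / 4) * ln (1 + b\<^sup>2))) at_top"
    proof (intro always_eventually allI)
      fix b :: real
      have "\<bar>powser bessel_coeff (- (b\<^sup>2 * y))\<bar> * ln (1 + b\<^sup>2) \<le>
              C * (1 + b\<^sup>2 * y) powr (- 1 / 4) * ln (1 + b\<^sup>2)"
        using y by (intro mult_right_mono C(2)) auto
      thus "norm (powser bessel_coeff (- (b\<^sup>2 * y)) * ln (1 + b\<^sup>2)) \<le>
              C * ((1 + b\<^sup>2 * y) powr (- 1 / 4) * ln (1 + b\<^sup>2))"
        by (simp add: abs_mult mult_ac)
    qed
    have "((\<lambda>b. (1 + b\<^sup>2 * y) powr (- 1 / 4) * ln (1 + b\<^sup>2)) \<longlongrightarrow> 0) at_top"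
      using y by real_asymp
    thus "((\<lambda>b. C * ((1 + b\<^sup>2 * y) powr (- 1 / 4) * ln (1 + b\<^sup>2))) \<longlongrightarrow> 0) at_top"
      by (rule tendsto_mult_right_zero)
  qed
  have "filterlim (\<lambda>b::real. b\<^sup>2) at_top at_top" by real_asymp
  note U = filterlim_compose[OF bessel_quotient_partial_integral_tendsto[OF y] this]
  have "((\<lambda>b. (integral {0..b\<^sup>2} (\<lambda>v. powser bessel_coeff (- (v * y)) / (1 + v))
           - powser bessel_coeff (- (b\<^sup>2 * y)) * ln (1 + b\<^sup>2)) / x) \<longlongrightarrow> (bessel_int 1 y - 0) / x) at_top"
    using x by (intro tendsto_intros U boundary) auto
  thus "((\<lambda>b. (integral {0..b\<^sup>2} (\<lambda>v. powser bessel_coeff (- (v * (x\<^sup>2 / 4))) / (1 + v))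
           - powser bessel_coeff (- (b\<^sup>2 * (x\<^sup>2 / 4))) * ln (1 + b\<^sup>2)) / x) \<longlongrightarrow> bessel_int 1 (x\<^sup>2 / 4) / x) at_top"
    by (simp add: y_def)
qed (rule bessel_log_partial_integral[OF x])

text \<open>\<open>F\<close> stands for the analytic continuation of the integral: holomorphy
  together with the values on the positive reals determines it on the slit plane.\<close>

theorem theorem25:
  "\<exists>F :: complex \<Rightarrow> complex.
     F holomorphic_on (- \<real>\<^sub>\<le>\<^sub>0) \<and>
     (\<forall>x::real. x > 0 \<longrightarrow>
        ((\<lambda>c::real. Bessel_J 1 (of_real c * of_real x) * of_real (ln (1 + c\<^sup>2)))
           has_integral F (of_real x)) {0..}) \<and>
     (\<forall>z. z \<notin> \<real>\<^sub>\<le>\<^sub>0 \<longrightarrow> F z = 2 * inverse z * Bessel_K 0 z)"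
proof (intro exI[of _ "\<lambda>z. 2 * inverse z * Bessel_K 0 z"] conjI allI impI)
  have "powser c holomorphic_on UNIV" if "entire_coeff c" for c :: "nat \<Rightarrow> complex"
    using powser_has_field_derivative[OF that] by (auto simp: holomorphic_on_open)
  moreover have "(\<lambda>z::complex. (z / 2)\<^sup>2) holomorphic_on A" for A by (intro holomorphic_intros) auto
  ultimately have hol: "(\<lambda>z. powser c ((z / 2)\<^sup>2)) holomorphic_on A"
    if "entire_coeff c" for c :: "nat \<Rightarrow> complex" and A
    using that holomorphic_on_compose_gen[of "\<lambda>z. (z / 2)\<^sup>2" A "powser c" UNIV]
    by (simp add: o_def)
  have "z / 2 \<in> \<real>\<^sub>\<le>\<^sub>0 \<longleftrightarrow> z \<in> \<real>\<^sub>\<le>\<^sub>0" for z :: complex by (auto simp: complex_nonpos_Reals_iff)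
  hence "(\<lambda>z. - (ln (z / 2) + euler_mascheroni) * powser bessel_coeff ((z / 2)\<^sup>2)
                         + powser bessel_harm_coeff ((z / 2)\<^sup>2)) holomorphic_on (- \<real>\<^sub>\<le>\<^sub>0)"
    by (intro holomorphic_intros hol entire_bessel_coeff entire_bessel_harm_coeff) auto
  \<comment> \<open>\<open>Bessel_K\<close> at order 0 is defined as a pointwise limit in the order,
    so its regularity in z is read off from the series formula.\<close>
  hence "Bessel_K 0 holomorphic_on (- \<real>\<^sub>\<le>\<^sub>0)"
    by (rule holomorphic_transform) (simp add: Bessel_K_0_series)
  thus "(\<lambda>z. 2 * inverse z * Bessel_K 0 z) holomorphic_on (- \<real>\<^sub>\<le>\<^sub>0)"
    by (intro holomorphic_intros) auto
next
  fix x :: real assume x: "x > 0"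
  have "Bessel_J 1 (of_real c * of_real x) * of_real (ln (1 + c\<^sup>2)) =
      complex_of_real (c * x / 2 * powser (diffs bessel_coeff) (- ((c * x / 2)\<^sup>2)) * ln (1 + c\<^sup>2))" for c
    using Bessel_J_1_of_real[of "c * x"] by simp
  moreover have "2 * inverse (of_real x) * Bessel_K 0 (of_real x) = of_real (bessel_int 1 (x\<^sup>2 / 4) / x)"
  proof -
    have "2 * inverse (of_real x) * Bessel_K 0 (of_real x) = inverse (of_real x) * (2 * Bessel_K 0 (of_real x))"
      by (simp only: mult_ac)
    also have "\<dots> = of_real (bessel_int 1 (x\<^sup>2 / 4) / x)"
      unfolding Bessel_K_0_of_real[OF x] by (subst of_real_divide) (rule divide_inverse_commute[symmetric])
    finally show ?thesis .
  qed
  ultimately show "((\<lambda>c::real. Bessel_J 1 (of_real c * of_real x) * of_real (ln (1 + c\<^sup>2)))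
           has_integral 2 * inverse (of_real x) * Bessel_K 0 (of_real x)) {0..}"
    using has_integral_of_real[OF bessel_log_integral[OF x], where 'b = complex] by (simp only:)
qed simp

end
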